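(* Consider the two-person zero-sum risk-sensitive average stochastic game with finite state and action spaces described in the context. For each $n\in\mathbb{N}$ define $$\lambda_n:=\Big(\max_{i\in E}\mathcal{L}^{2^n}\mathbf{1}(i)\Big)^{1/2^n},\qquad \zeta_n:=\Big(\min_{i\in E}\mathcal{L}^{2^n}\mathbf{1}(i)\Big)^{1/2^n},$$ where $\mathbf{1}$ is the constant function one on $E$. Assume the irreducibility condition: for every pair of deterministic stationary policies $(f,g)\in\Pi_1^{sd}\times\Pi_2^{sd}$, the Markov chain $\{X_n,n\in\mathbb{N}\}$ is irreducible under $(f,g)$. Let $\rho^*$ be the value of the game (under this condition the value exists and is a constant independent of the initial state). Then: (a) The sequence $\{\theta^{-1}\ln\lambda_n,n\in\mathbb{N}\}$ is decreasing (in the weak sense) in $n$ and $\rho^*=\lim_{n\to\infty}\theta^{-1}\ln\lambda_n$. (b) The sequence $\{\theta^{-1}\ln\zeta_n,n\in\mathbb{N}\}$ is increasing (in the weak sense) in $n$ and $\rho^*=\lim_{n\to\infty}\theta^{-1}\ln\zeta_n$. (c) Given any $\varepsilon>0$, there exists a positive integer $n_\varepsilon$ such that $\lambda_{n_\varepsilon}/\zeta_{n_\varepsilon}\le e^{\theta\varepsilon}$. Therefore, $0\le\theta^{-1}\ln\lambda_{n_\varepsilon}-\rho^*\le\varepsilon$, and thus $\theta^{-1}\ln\lambda_{n_\varepsilon}$ is an $\varepsilon$-approximation of the value.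
   Context: Game data: $\theta\in(0,\infty)$ is a risk-sensitivity parameter; $E$ (states), $A$, $B$ (actions of players 1 and 2) are finite nonempty sets; for each $i\in E$, $A(i)\subset A$ and $B(i)\subset B$ are the nonempty sets of admissible actions; $\mathbb{K}:=\{(i,a,b): i\in E,a\in A(i),b\in B(i)\}$; $P(\cdot|i,a,b)$ is a probability distribution on $E$ for each $(i,a,b)\in\mathbb{K}$; $c:\mathbb{K}\to[0,\infty)$ is the cost to player 1 and reward to player 2 (assumed nonnegative). $\mathbb{N}=\{0,1,2,\ldots\}$. Policies: Let $H_0=E$, $H_n=\mathbb{K}^n\times E$ for $n\ge1$. A (randomized history-dependent) policy of player 1 is a sequence $\pi=\{\pi_n,n\in\mathbb{N}\}$ of stochastic kernels $\pi_n$ on $A$ given $H_n$ with $\pi_n(A(i_n)|h_n)=1$ for all $h_n=(i_0,a_0,b_0,\ldots,i_{n-1},a_{n-1},b_{n-1},i_n)\in H_n$. It is deterministic stationary if there is a map $f:E\to A$ with $\pi_n(\cdot|h_n)=\delta_{f(i_n)}$ for all $n,h_n$ (then $\pi$ is written $f$). $\Pi_1$ and $\Pi_1^{sd}$ are the sets of all policies and of all deterministic stationary policies of player 1; $\Pi_2,\Pi_2^{sd}$ are defined analogously for player 2 with $B,B(i)$. For $i\in E$, $(\pi,\sigma)\in\Pi_1\times\Pi_2$, $\mathbb{P}_i^{\pi,\sigma}$ is the unique probability measure on $(E\times A\times B)^\infty$ with coordinate processes $X_n,A_n,B_n$ such that $X_0=i$ a.s.; given the history $h_n$ up to time $n$,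 $A_n$ and $B_n$ are independent with laws $\pi_n(\cdot|h_n)$, $\sigma_n(\cdot|h_n)$; and given $h_n,a_n,b_n$, $X_{n+1}$ has law $P(\cdot|i_n,a_n,b_n)$. $\mathbb{E}_i^{\pi,\sigma}$ is its expectation. Irreducible means: for all $i,j\in E$ there is $n\ge1$ with $\mathbb{P}_i^{f,g}(X_n=j)>0$. Criterion: $J(i,\pi,\sigma):=\limsup_{n\to\infty}\frac{1}{\theta n}\ln\mathbb{E}_i^{\pi,\sigma}\big[e^{\theta\sum_{k=0}^{n-1}c(X_k,A_k,B_k)}\big]$. The value exists if $\inf_{\pi\in\Pi_1}\sup_{\sigma\in\Pi_2}J(i,\pi,\sigma)=\sup_{\sigma\in\Pi_2}\inf_{\pi\in\Pi_1}J(i,\pi,\sigma)$ for all $i\in E$; the common function is the value $J^*(i)$. A constant $r\in\mathbb{R}$ is an $\varepsilon$-approximation of the value if $\max_{i\in E}|J^*(i)-r|\le\varepsilon$. Operator: $\mathcal{P}(A(i)),\mathcal{P}(B(i))$ are the sets of probability measures on $A(i),B(i)$. For $h:E\to[0,\infty)$, $$\mathcal{L}h(i):=\inf_{\mu\in\mathcal{P}(A(i))}\sup_{\nu\in\mathcal{P}(B(i))}\sum_{a\in A(i)}\sum_{b\in B(i)}\sum_{j\in E}e^{\theta c(i,a,b)}h(j)P(j|i,a,b)\mu(a)\nu(b),$$ $\mathcal{L}^0h=h$, $\mathcal{L}^nh=\mathcal{L}(\mathcal{L}^{n-1}h)$. *)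

theory Defs
  imports "HOL-Probability.Probability"
begin

section \<open>Game data\<close>

text \<open>
  The finite nonempty sets of states and of actions of the two players are finite types. Values of
  the fields outside the admissible triples are irrelevant to all notions below.
\<close>

record ('s, 'a, 'b) game =
  risk :: real
  act1 :: "'s \<Rightarrow> 'a set"
  act2 :: "'s \<Rightarrow> 'b set"
  trans :: "'s \<Rightarrow> 'a \<Rightarrow> 'b \<Rightarrow> 's pmf"
  cost :: "'s \<Rightarrow> 'a \<Rightarrow> 'b \<Rightarrow> real"

definition adm :: "('s::finite, 'a::finite, 'b::finite) game \<Rightarrow> ('s \<times> 'a \<times> 'b) set" where
  "adm G = {(i, a, b). a \<in> act1 G i \<and> b \<in> act2 G i}"

definition risk_game :: "('s::finite, 'a::finite, 'b::finite) game \<Rightarrow> bool" where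
  "risk_game G \<longleftrightarrow>
     risk G > 0 \<and> (\<forall>i. act1 G i \<noteq> {}) \<and> (\<forall>i. act2 G i \<noteq> {}) \<and>
     (\<forall>(i, a, b) \<in> adm G. cost G i a b \<ge> 0)"


section \<open>Policies\<close>

type_synonym ('s, 'a, 'b) hist = "('s \<times> 'a \<times> 'b) list \<times> 's"

definition hists :: "('s::finite, 'a::finite, 'b::finite) game \<Rightarrow> nat \<Rightarrow> ('s, 'a, 'b) hist set" where
  "hists G n = {(xs, i). length xs = n \<and> set xs \<subseteq> adm G}"

definition policies1 ::
  "('s::finite, 'a::finite, 'b::finite) game \<Rightarrow> (nat \<Rightarrow> ('s, 'a, 'b) hist \<Rightarrow> 'a pmf) set" where
  "policies1 G = {\<pi>. \<forall>n. \<forall>(xs, i) \<in> hists G n. set_pmf (\<pi> n (xs, i)) \<subseteq> act1 G i}"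

definition policies2 ::
  "('s::finite, 'a::finite, 'b::finite) game \<Rightarrow> (nat \<Rightarrow> ('s, 'a, 'b) hist \<Rightarrow> 'b pmf) set" where
  "policies2 G = {\<sigma>. \<forall>n. \<forall>(xs, i) \<in> hists G n. set_pmf (\<sigma> n (xs, i)) \<subseteq> act2 G i}"

definition sd_policies1 ::
  "('s::finite, 'a::finite, 'b::finite) game \<Rightarrow> (nat \<Rightarrow> ('s, 'a, 'b) hist \<Rightarrow> 'a pmf) set" where
  "sd_policies1 G =
     {\<pi> \<in> policies1 G. \<exists>f. \<forall>n. \<forall>(xs, i) \<in> hists G n. \<pi> n (xs, i) = return_pmf (f i)}"

definition sd_policies2 ::
  "('s::finite, 'a::finite, 'b::finite) game \<Rightarrow> (nat \<Rightarrow> ('s, 'a, 'b) hist \<Rightarrow> 'b pmf) set" where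
  "sd_policies2 G =
     {\<sigma> \<in> policies2 G. \<exists>g. \<forall>n. \<forall>(xs, i) \<in> hists G n. \<sigma> n (xs, i) = return_pmf (g i)}"


section \<open>The law of the play\<close>

text \<open>
  A trajectory is a sequence \<open>\<omega>\<close> whose coordinate \<open>\<omega> n\<close> is \<open>(X n, A n, B n)\<close>. The conditional law
  of coordinate \<open>n\<close> given the previous ones is \<open>step_law\<close>, which reads \<open>\<omega>\<close> only below \<open>n\<close>.
  The law of the trajectory is the Ionescu-Tulcea measure of these kernels.
\<close>

definition state_law ::
  "('s::finite, 'a::finite, 'b::finite) game \<Rightarrow> 's \<Rightarrow> nat \<Rightarrow> (nat \<Rightarrow> 's \<times> 'a \<times> 'b) \<Rightarrow> 's pmf" where
  "state_law G i n \<omega> =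
     (case n of 0 \<Rightarrow> return_pmf i | Suc m \<Rightarrow> (case \<omega> m of (x, a, b) \<Rightarrow> trans G x a b))"

definition step_law ::
  "('s::finite, 'a::finite, 'b::finite) game \<Rightarrow> 's \<Rightarrow> (nat \<Rightarrow> ('s, 'a, 'b) hist \<Rightarrow> 'a pmf) \<Rightarrow>
   (nat \<Rightarrow> ('s, 'a, 'b) hist \<Rightarrow> 'b pmf) \<Rightarrow> nat \<Rightarrow> (nat \<Rightarrow> 's \<times> 'a \<times> 'b) \<Rightarrow> ('s \<times> 'a \<times> 'b) pmf" where
  "step_law G i \<pi> \<sigma> n \<omega> =
     bind_pmf (state_law G i n \<omega>) (\<lambda>x.
       let h = (map \<omega> [0..<n], x)
       in map_pmf (Pair x) (pair_pmf (\<pi> n h) (\<sigma> n h)))"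

definition play_law ::
  "('s::finite, 'a::finite, 'b::finite) game \<Rightarrow> 's \<Rightarrow> (nat \<Rightarrow> ('s, 'a, 'b) hist \<Rightarrow> 'a pmf) \<Rightarrow>
   (nat \<Rightarrow> ('s, 'a, 'b) hist \<Rightarrow> 'b pmf) \<Rightarrow> (nat \<Rightarrow> 's \<times> 'a \<times> 'b) measure" where
  "play_law G i \<pi> \<sigma> =
     projective_family.lim UNIV
       (Ionescu_Tulcea.CI (\<lambda>n \<omega>. measure_pmf (step_law G i \<pi> \<sigma> n \<omega>)) (\<lambda>_. count_space UNIV))
       (\<lambda>_. count_space UNIV)"

lemma Ionescu_Tulcea_step_law:
  "Ionescu_Tulcea (\<lambda>n \<omega>. measure_pmf (step_law G i \<pi> \<sigma> n \<omega>)) (\<lambda>_. count_space UNIV)"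
proof
  fix n :: nat
  have "PiM {0..<n} (\<lambda>_. count_space (UNIV :: ('a \<times> 'b \<times> 'c) set)) =
      count_space (PiE {0..<n} (\<lambda>_. UNIV))"
    by (rule count_space_PiM_finite) auto
  then show "(\<lambda>\<omega>. measure_pmf (step_law G i \<pi> \<sigma> n \<omega>))
      \<in> PiM {0..<n} (\<lambda>_. count_space UNIV) \<rightarrow>\<^sub>M subprob_algebra (count_space UNIV)"
    by (auto simp: space_subprob_algebra prob_space_measure_pmf prob_space_imp_subprob_space)
qed

lemma prob_space_play_law: "prob_space (play_law G i \<pi> \<sigma>)"
proof -
  interpret Ionescu_Tulcea "\<lambda>n \<omega>. measure_pmf (step_law G i \<pi> \<sigma> n \<omega>)" "\<lambda>_. count_space UNIV"
    by (rule Ionescu_Tulcea_step_law)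
  have "prob_space (distr PF.lim (PiM {} (\<lambda>_. count_space UNIV)) (\<lambda>x. restrict x {}))"
    by (subst distr_lim) (auto intro: PF.prob_space_P)
  then have "prob_space PF.lim"
    by (rule prob_space_distrD[rotated]) (auto intro!: measurable_restrict)
  then show ?thesis
    by (simp add: play_law_def)
qed

lemma step_law_cong:
  assumes "\<And>k. k < n \<Longrightarrow> \<omega> k = \<omega>' k"
  shows "step_law G i \<pi> \<sigma> n \<omega> = step_law G i \<pi> \<sigma> n \<omega>'"
proof -
  have "map \<omega> [0..<n] = map \<omega>' [0..<n]"
    using assms by simp
  moreover have "state_law G i n \<omega> = state_law G i n \<omega>'"
    using assms by (auto simp: state_law_def split: nat.splits)
  ultimately show ?thesis
    unfolding step_law_def by (simp only:)
qed

lemma pmf_step_law: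
  "pmf (step_law G i \<pi> \<sigma> n \<omega>) (x, a, b) =
     pmf (state_law G i n \<omega>) x * pmf (\<pi> n (map \<omega> [0..<n], x)) a * pmf (\<sigma> n (map \<omega> [0..<n], x)) b"
proof -
  let ?pp = "\<lambda>y. pair_pmf (\<pi> n (map \<omega> [0..<n], y)) (\<sigma> n (map \<omega> [0..<n], y))"
  have "pmf (map_pmf (Pair y) (?pp y)) (x, a, b) =
      indicator {x} y * (pmf (\<pi> n (map \<omega> [0..<n], x)) a * pmf (\<sigma> n (map \<omega> [0..<n], x)) b)" for y
  proof (cases "y = x")
    case True
    then show ?thesis
      using pmf_map_inj'[of "Pair x" "?pp x" "(a, b)"] by (simp add: inj_on_def pmf_pair)
  next
    case False
    then have "(x, a, b) \<notin> set_pmf (map_pmf (Pair y) (?pp y))"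
      by auto
    then have "pmf (map_pmf (Pair y) (?pp y)) (x, a, b) = 0"
      by (simp only: set_pmf_iff not_not)
    then show ?thesis
      using False by simp
  qed
  then show ?thesis
    by (simp add: step_law_def Let_def pmf_bind measure_pmf_single mult.assoc)
qed

text \<open>The finite-dimensional distributions, which determine the law.\<close>

lemma emeasure_play_law_cylinder:
  fixes w :: "nat \<Rightarrow> 's::finite \<times> 'a::finite \<times> 'b::finite"
  shows "emeasure (play_law G i \<pi> \<sigma>) {\<omega>. \<forall>k<n. \<omega> k = w k} =
    (\<Prod>k<n. ennreal (pmf (step_law G i \<pi> \<sigma> k w) (w k)))"
proof -
  let ?M = "\<lambda>_. count_space UNIV :: ('s \<times> 'a \<times> 'b) measure"
  interpret Ionescu_Tulcea "\<lambda>n \<omega>. measure_pmf (step_law G i \<pi> \<sigma> n \<omega>)" ?M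
    by (rule Ionescu_Tulcea_step_law)
  define r where "r n = restrict w {0..<n}" for n :: nat
  have PiM_eq: "PiM {0..<n} ?M = count_space (PiE {0..<n} (\<lambda>_. UNIV))" for n :: nat
    by (rule count_space_PiM_finite) auto
  have r_sets: "{r n} \<in> sets (PiM {0..<n} ?M)" for n
    by (simp add: PiM_eq r_def)
  have u: "(\<lambda>_. undefined) \<in> space (PiM {0..<(0::nat)} ?M)"
    by (simp add: space_PiM)
  have C: "emeasure (C 0 n (\<lambda>_. undefined)) {r n} =
      (\<Prod>k<n. ennreal (pmf (step_law G i \<pi> \<sigma> k w) (w k)))" for n
  proof (induction n)
    case 0
    have "r 0 = (\<lambda>_. undefined)"
      by (simp add: r_def restrict_def)
    then show ?case
      using r_sets[of 0] by simp
  next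
    case (Suc n)
    let ?p = "ennreal (pmf (step_law G i \<pi> \<sigma> n w) (w n))"
    have sp: "space (C 0 n (\<lambda>_. undefined)) = PiE {0..<n} (\<lambda>_. UNIV)"
      using space_C[OF u, of n] by (simp add: space_PiM)
    have e: "emeasure (eP n \<omega>) {r (Suc n)} = ?p * indicator {r n} \<omega>"
      if \<omega>: "\<omega> \<in> PiE {0..<n} (\<lambda>_. UNIV)" for \<omega>
    proof -
      have \<omega>': "\<omega> \<in> space (PiM {0..<n} ?M)"
        using \<omega> by (simp add: space_PiM)
      have eq: "fun_upd \<omega> n x = r (Suc n) \<longleftrightarrow> \<omega> = r n \<and> x = w n" for x
      proof
        assume *: "fun_upd \<omega> n x = r (Suc n)"
        have "\<omega> k = r n k" for k
          using fun_cong[OF *, of k] PiE_arb[OF \<omega>, of k]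
          by (auto simp: r_def split: if_splits)
        moreover have "x = w n"
          using fun_cong[OF *, of n] by (simp add: r_def)
        ultimately show "\<omega> = r n \<and> x = w n"
          by auto
      next
        assume "\<omega> = r n \<and> x = w n"
        then show "fun_upd \<omega> n x = r (Suc n)"
          by (auto simp: r_def fun_eq_iff)
      qed
      have "emeasure (eP n \<omega>) {r (Suc n)} =
          emeasure (measure_pmf (step_law G i \<pi> \<sigma> n \<omega>)) (fun_upd \<omega> n -` {r (Suc n)})"
        using emeasure_eP[OF \<omega>' r_sets] by simp
      also have "fun_upd \<omega> n -` {r (Suc n)} = (if \<omega> = r n then {w n} else {})"
        using eq by auto
      also have "emeasure (measure_pmf (step_law G i \<pi> \<sigma> n \<omega>)) \<dots> = ?p * indicator {r n} \<omega>"
        using step_law_cong[of n "r n" w G i \<pi> \<sigma>] by (auto simp: emeasure_pmf_single r_def)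
      finally show ?thesis .
    qed
    have mC: "C 0 n (\<lambda>_. undefined) \<in> space (subprob_algebra (PiM {0..<n} ?M))"
      using measurable_space[OF measurable_C u, of n] by simp
    have setsC: "sets (C 0 n (\<lambda>_. undefined)) = sets (PiM {0..<n} ?M)"
      using sets_C[OF u, of n] by simp
    have "emeasure (C 0 (Suc n) (\<lambda>_. undefined)) {r (Suc n)} =
        (\<integral>\<^sup>+\<omega>. emeasure (eP n \<omega>) {r (Suc n)} \<partial>C 0 n (\<lambda>_. undefined))"
      unfolding C.simps add_0
    proof (rule emeasure_bind)
      show "space (C 0 n (\<lambda>_. undefined)) \<noteq> {}"
        by (auto simp: sp PiE_eq_empty_iff)
      show "eP n \<in> C 0 n (\<lambda>_. undefined) \<rightarrow>\<^sub>M subprob_algebra (PiM {0..<Suc n} ?M)"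
        using measurable_eP[of n] measurable_cong_sets[OF setsC refl] by blast
    qed (rule r_sets)
    also have "\<dots> = (\<integral>\<^sup>+\<omega>. ?p * indicator {r n} \<omega> \<partial>C 0 n (\<lambda>_. undefined))"
      by (rule nn_integral_cong) (simp add: sp e)
    also have "\<dots> = ?p * emeasure (C 0 n (\<lambda>_. undefined)) {r n}"
      using r_sets[of n] setsC by (subst nn_integral_cmult_indicator) auto
    also have "\<dots> = (\<Prod>k<Suc n. ennreal (pmf (step_law G i \<pi> \<sigma> k w) (w k)))"
      unfolding Suc.IH by (simp add: mult.commute)
    finally show ?case .
  qed
  have "{\<omega>. \<forall>k<n. \<omega> k = w k} = PF.emb UNIV {0..<n} {r n}"
    by (auto simp: prod_emb_def r_def fun_eq_iff restrict_def) meson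
  then have "emeasure (play_law G i \<pi> \<sigma>) {\<omega>. \<forall>k<n. \<omega> k = w k} = emeasure (CI {0..<n}) {r n}"
    using lim[OF _ r_sets[of n]] by (simp add: play_law_def)
  also have "\<dots> = emeasure (C 0 n (\<lambda>_. undefined)) (PF.emb {0..<n} {0..<n} {r n})"
    by (rule emeasure_CI) (use r_sets in auto)
  also have "PF.emb {0..<n} {0..<n} {r n} = {r n}"
    by (rule prod_emb_id) (auto simp: r_def)
  finally show ?thesis
    using C by simp
qed


section \<open>The risk-sensitive average criterion and the value\<close>

definition irreducible_under ::
  "('s::finite, 'a::finite, 'b::finite) game \<Rightarrow> (nat \<Rightarrow> ('s, 'a, 'b) hist \<Rightarrow> 'a pmf) \<Rightarrow>
   (nat \<Rightarrow> ('s, 'a, 'b) hist \<Rightarrow> 'b pmf) \<Rightarrow> bool" where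
  "irreducible_under G f g \<longleftrightarrow>
     (\<forall>i j. \<exists>n\<ge>1. measure (play_law G i f g) {\<omega>. fst (\<omega> n) = j} > 0)"

definition criterion ::
  "('s::finite, 'a::finite, 'b::finite) game \<Rightarrow> 's \<Rightarrow> (nat \<Rightarrow> ('s, 'a, 'b) hist \<Rightarrow> 'a pmf) \<Rightarrow>
   (nat \<Rightarrow> ('s, 'a, 'b) hist \<Rightarrow> 'b pmf) \<Rightarrow> ereal" where
  "criterion G i \<pi> \<sigma> =
     limsup (\<lambda>n. ereal (1 / (risk G * real n) *
       ln (\<integral>\<omega>. exp (risk G * (\<Sum>k<n. case \<omega> k of (x, a, b) \<Rightarrow> cost G x a b)) \<partial>play_law G i \<pi> \<sigma>)))"

definition upper_value :: "('s::finite, 'a::finite, 'b::finite) game \<Rightarrow> 's \<Rightarrow> ereal" where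
  "upper_value G i = (INF \<pi>\<in>policies1 G. SUP \<sigma>\<in>policies2 G. criterion G i \<pi> \<sigma>)"

definition lower_value :: "('s::finite, 'a::finite, 'b::finite) game \<Rightarrow> 's \<Rightarrow> ereal" where
  "lower_value G i = (SUP \<sigma>\<in>policies2 G. INF \<pi>\<in>policies1 G. criterion G i \<pi> \<sigma>)"

definition value_exists :: "('s::finite, 'a::finite, 'b::finite) game \<Rightarrow> bool" where
  "value_exists G \<longleftrightarrow> (\<forall>i. upper_value G i = lower_value G i)"

text \<open>Only meaningful when \<open>value_exists G\<close> holds.\<close>

definition game_value :: "('s::finite, 'a::finite, 'b::finite) game \<Rightarrow> 's \<Rightarrow> ereal" where
  "game_value G i = upper_value G i"

definition approximates_value ::
  "('s::finite, 'a::finite, 'b::finite) game \<Rightarrow> real \<Rightarrow> real \<Rightarrow> bool" where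
  "approximates_value G \<epsilon> r \<longleftrightarrow> (MAX i. \<bar>game_value G i - ereal r\<bar>) \<le> ereal \<epsilon>"


section \<open>The operator and its iterates\<close>

definition L_op ::
  "('s::finite, 'a::finite, 'b::finite) game \<Rightarrow> ('s \<Rightarrow> real) \<Rightarrow> 's \<Rightarrow> real" where
  "L_op G h i =
     (INF \<mu>\<in>{\<mu>. set_pmf \<mu> \<subseteq> act1 G i}. SUP \<nu>\<in>{\<nu>. set_pmf \<nu> \<subseteq> act2 G i}.
       \<Sum>a\<in>act1 G i. \<Sum>b\<in>act2 G i. \<Sum>j\<in>UNIV.
         exp (risk G * cost G i a b) * h j * pmf (trans G i a b) j * pmf \<mu> a * pmf \<nu> b)"

definition lam :: "('s::finite, 'a::finite, 'b::finite) game \<Rightarrow> nat \<Rightarrow> real" where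
  "lam G n = root (2 ^ n) (MAX i. (L_op G ^^ (2 ^ n)) (\<lambda>_. 1) i)"

definition zet :: "('s::finite, 'a::finite, 'b::finite) game \<Rightarrow> nat \<Rightarrow> real" where
  "zet G n = root (2 ^ n) (MIN i. (L_op G ^^ (2 ^ n)) (\<lambda>_. 1) i)"

end

theory Submission
  imports Defs
begin

text \<open>
  The operator \<open>L_op\<close> takes, in each state, the value of a matrix game. It is monotone and positively
  homogeneous, so the maximum of its iterates at the constant function one is submultiplicative and
  the minimum supermultiplicative in the number of steps. Along powers of two this makes \<open>lam\<close>
  decreasing and \<open>zet\<close> increasing.

  Both have the same limit because maximum and minimum stay comparable. By irreducibility, no proper
  nonempty set of states can be kept forever even if the players cooperate. Hence every state is reached from
  every other one within a bounded time, with a probability bounded below, however the players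
  behave, which yields a Harnack inequality (\<open>harnack\<close>) for functions that do not decrease
  under the operator. As the costs are nonnegative, the iterates of one are such functions.

  To identify the common limit with the value of the game, fix \<open>n\<close>. The minimum of suitably rescaled
  iterates is a positive function \<open>h\<close> with \<open>L_op G h \<le> lam G n * h\<close> (\<open>superharmonic_exists\<close>), and dually
  a maximum satisfies \<open>zet G n * h \<le> L_op G h\<close> (\<open>subharmonic_exists\<close>). Near-optimal mixed actions in the
  matrix games for \<open>h\<close> define stationary policies, and induction over the stages shows that the
  policy of player 1 keeps the growth rate below any level above \<open>lam G n\<close> against every opponent
  (\<open>upper_value_le\<close>), while that of player 2 keeps it above any level below \<open>zet G n\<close>
  (\<open>lower_value_ge\<close>). The latter rests on the minimax theorem for matrix games (\<open>matrix_minimax\<close>). So the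
  upper and the lower value both lie between the \<open>n\<close>-th terms of the two sequences, for every \<open>n\<close>.
\<close>

section \<open>Matrix games\<close>

definition mixed_payoff ::
  "'a set \<Rightarrow> 'b set \<Rightarrow> ('a \<Rightarrow> 'b \<Rightarrow> real) \<Rightarrow> 'a pmf \<Rightarrow> 'b pmf \<Rightarrow> real" where
  "mixed_payoff A B Q \<mu> \<nu> = (\<Sum>a\<in>A. \<Sum>b\<in>B. Q a b * pmf \<mu> a * pmf \<nu> b)"

definition matrix_value :: "'a set \<Rightarrow> 'b set \<Rightarrow> ('a \<Rightarrow> 'b \<Rightarrow> real) \<Rightarrow> real" where
  "matrix_value A B Q =
     (INF \<mu>\<in>{\<mu>. set_pmf \<mu> \<subseteq> A}. SUP \<nu>\<in>{\<nu>. set_pmf \<nu> \<subseteq> B}. mixed_payoff A B Q \<mu> \<nu>)"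

lemma mixed_payoff_mono:
  assumes "\<And>a b. a \<in> A \<Longrightarrow> b \<in> B \<Longrightarrow> Q a b \<le> Q' a b"
  shows "mixed_payoff A B Q \<mu> \<nu> \<le> mixed_payoff A B Q' \<mu> \<nu>"
  unfolding mixed_payoff_def using assms by (intro sum_mono mult_right_mono) auto

lemma mixed_payoff_const:
  fixes A :: "'a::finite set" and B :: "'b::finite set"
  assumes "set_pmf \<mu> \<subseteq> A" "set_pmf \<nu> \<subseteq> B"
  shows "mixed_payoff A B (\<lambda>_ _. r) \<mu> \<nu> = r"
proof -
  have "mixed_payoff A B (\<lambda>_ _. r) \<mu> \<nu> = r * ((\<Sum>a\<in>A. pmf \<mu> a) * (\<Sum>b\<in>B. pmf \<nu> b))"
    unfolding mixed_payoff_def sum_product by (simp add: sum_distrib_left mult.assoc)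
  then show ?thesis
    using assms by (simp add: sum_pmf_eq_1)
qed

lemma mixed_payoff_scale:
  "mixed_payoff A B (\<lambda>a b. r * Q a b) \<mu> \<nu> = r * mixed_payoff A B Q \<mu> \<nu>"
  by (simp add: mixed_payoff_def sum_distrib_left mult.assoc)

text \<open>
Boundedness of the payoff is what makes the real-valued infimum and supremum in the value of a
matrix game meaningful.
\<close>

lemma mixed_payoff_abs_le:
  fixes A :: "'a::finite set" and B :: "'b::finite set"
  assumes "set_pmf \<mu> \<subseteq> A" "set_pmf \<nu> \<subseteq> B"
  shows "\<bar>mixed_payoff A B Q \<mu> \<nu>\<bar> \<le> (\<Sum>a\<in>A. \<Sum>b\<in>B. \<bar>Q a b\<bar>)"
proof -
  have le: "\<bar>Q a b\<bar> \<le> (\<Sum>a\<in>A. \<Sum>b\<in>B. \<bar>Q a b\<bar>)" (is "_ \<le> ?R") if "a \<in> A" "b \<in> B" for a b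
  proof -
    have "\<bar>Q a b\<bar> \<le> (\<Sum>b\<in>B. \<bar>Q a b\<bar>)"
      using that by (intro member_le_sum) auto
    also have "\<dots> \<le> ?R"
      using that by (intro member_le_sum[where f = "\<lambda>a. \<Sum>b\<in>B. \<bar>Q a b\<bar>"]) (auto intro: sum_nonneg)
    finally show ?thesis .
  qed
  have "Q a b \<le> ?R" "- ?R \<le> Q a b" if "a \<in> A" "b \<in> B" for a b
    using le[OF that] by linarith+
  then have "mixed_payoff A B Q \<mu> \<nu> \<le> mixed_payoff A B (\<lambda>_ _. ?R) \<mu> \<nu>"
    and "mixed_payoff A B (\<lambda>_ _. - ?R) \<mu> \<nu> \<le> mixed_payoff A B Q \<mu> \<nu>"
    by (intro mixed_payoff_mono; simp)+
  then show ?thesis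
    unfolding mixed_payoff_const[OF assms] by (intro abs_leI) linarith+
qed

lemma pmf_supported_exists: "A \<noteq> {} \<Longrightarrow> \<exists>\<mu>. set_pmf \<mu> \<subseteq> A"
  by (metis empty_subsetI ex_in_conv insert_subset set_return_pmf)

lemma nonpos_if_affine_bounded:
  fixes x K d :: real
  assumes "\<And>t. t \<ge> 0 \<Longrightarrow> K + t * x \<le> d"
  shows "x \<le> 0"
proof (rule ccontr)
  assume "\<not> x \<le> 0"
  then have "K + (\<bar>d - K\<bar> + 1) / x * x \<le> d"
    by (intro assms) auto
  then show False
    using \<open>\<not> x \<le> 0\<close> by (simp add: abs_if split: if_splits)
qed

context
  fixes A :: "'a::finite set" and B :: "'b::finite set"
  assumes A_ne: "A \<noteq> {}" and B_ne: "B \<noteq> {}"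
begin

text \<open>
This lemma and the next one characterise the value from above by guarantees of single mixed
strategies of the minimiser. Monotonicity, homogeneity and the minimax theorem are derived from
them, with strict inequalities in the role of optimal strategies.
\<close>

lemma matrix_value_le:
  assumes \<mu>: "set_pmf \<mu> \<subseteq> A"
    and le: "\<And>\<nu>. set_pmf \<nu> \<subseteq> B \<Longrightarrow> mixed_payoff A B Q \<mu> \<nu> \<le> v"
  shows "matrix_value A B Q \<le> v"
proof -
  let ?R = "\<Sum>a\<in>A. \<Sum>b\<in>B. \<bar>Q a b\<bar>"
  obtain \<nu> where \<nu>: "set_pmf \<nu> \<subseteq> B"
    using pmf_supported_exists[OF B_ne] by blast
  have "- ?R \<le> (SUP \<nu>\<in>{\<nu>. set_pmf \<nu> \<subseteq> B}. mixed_payoff A B Q \<mu>' \<nu>)" if "set_pmf \<mu>' \<subseteq> A" for \<mu>'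
  proof -
    have "- ?R \<le> mixed_payoff A B Q \<mu>' \<nu>"
      using mixed_payoff_abs_le[OF that \<nu>, of Q] by linarith
    also have "\<dots> \<le> (SUP \<nu>\<in>{\<nu>. set_pmf \<nu> \<subseteq> B}. mixed_payoff A B Q \<mu>' \<nu>)"
      using \<nu> mixed_payoff_abs_le[OF that] by (intro cSUP_upper bdd_aboveI2) (auto simp: abs_le_iff)
    finally show ?thesis .
  qed
  then have "bdd_below ((\<lambda>\<mu>. SUP \<nu>\<in>{\<nu>. set_pmf \<nu> \<subseteq> B}. mixed_payoff A B Q \<mu> \<nu>) ` {\<mu>. set_pmf \<mu> \<subseteq> A})"
    by (intro bdd_belowI2) auto
  moreover have "(SUP \<nu>\<in>{\<nu>. set_pmf \<nu> \<subseteq> B}. mixed_payoff A B Q \<mu> \<nu>) \<le> v"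
    using \<nu> le by (intro cSUP_least) auto
  ultimately show ?thesis
    unfolding matrix_value_def using \<mu> by (intro cINF_lower2[where x = \<mu>]) auto
qed

lemma matrix_value_less_obtains:
  assumes "matrix_value A B Q < v"
  obtains \<mu> where "set_pmf \<mu> \<subseteq> A" "\<And>\<nu>. set_pmf \<nu> \<subseteq> B \<Longrightarrow> mixed_payoff A B Q \<mu> \<nu> \<le> v"
proof -
  have "\<exists>\<mu>\<in>{\<mu>. set_pmf \<mu> \<subseteq> A}. (SUP \<nu>\<in>{\<nu>. set_pmf \<nu> \<subseteq> B}. mixed_payoff A B Q \<mu> \<nu>) < v"
    using assms pmf_supported_exists[OF A_ne] unfolding matrix_value_def
    using cInf_lessD[of "(\<lambda>\<mu>. SUP \<nu>\<in>{\<nu>. set_pmf \<nu> \<subseteq> B}. mixed_payoff A B Q \<mu> \<nu>) ` {\<mu>. set_pmf \<mu> \<subseteq> A}" v]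
    by auto
  then obtain \<mu> where \<mu>: "set_pmf \<mu> \<subseteq> A"
    and less: "(SUP \<nu>\<in>{\<nu>. set_pmf \<nu> \<subseteq> B}. mixed_payoff A B Q \<mu> \<nu>) < v"
    by auto
  have "mixed_payoff A B Q \<mu> \<nu> \<le> v" if "set_pmf \<nu> \<subseteq> B" for \<nu>
  proof -
    have "mixed_payoff A B Q \<mu> \<nu> \<le> (SUP \<nu>\<in>{\<nu>. set_pmf \<nu> \<subseteq> B}. mixed_payoff A B Q \<mu> \<nu>)"
      using that mixed_payoff_abs_le[OF \<mu>] by (intro cSUP_upper bdd_aboveI2) (auto simp: abs_le_iff)
    then show ?thesis
      using less by linarith
  qed
  then show thesis
    using \<mu> that by blast
qed

lemma matrix_value_mono:
  assumes "\<And>a b. a \<in> A \<Longrightarrow> b \<in> B \<Longrightarrow> Q a b \<le> Q' a b"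
  shows "matrix_value A B Q \<le> matrix_value A B Q'"
proof (rule dense_ge)
  fix v assume "matrix_value A B Q' < v"
  then obtain \<mu> where \<mu>: "set_pmf \<mu> \<subseteq> A"
    and le: "\<And>\<nu>. set_pmf \<nu> \<subseteq> B \<Longrightarrow> mixed_payoff A B Q' \<mu> \<nu> \<le> v"
    using matrix_value_less_obtains by blast
  show "matrix_value A B Q \<le> v"
    using order_trans[OF mixed_payoff_mono le, OF assms] by (rule matrix_value_le[OF \<mu>])
qed

lemma matrix_value_const: "matrix_value A B (\<lambda>_ _. r) = r"
proof (rule antisym)
  obtain \<mu> where \<mu>: "set_pmf \<mu> \<subseteq> A"
    using pmf_supported_exists[OF A_ne] by blast
  show "matrix_value A B (\<lambda>_ _. r) \<le> r"
    by (rule matrix_value_le[OF \<mu>]) (simp add: mixed_payoff_const[OF \<mu>])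
  obtain \<nu> where \<nu>: "set_pmf \<nu> \<subseteq> B"
    using pmf_supported_exists[OF B_ne] by blast
  show "r \<le> matrix_value A B (\<lambda>_ _. r)"
  proof (rule dense_ge)
    fix v assume "matrix_value A B (\<lambda>_ _. r) < v"
    then obtain \<mu> where "set_pmf \<mu> \<subseteq> A" "mixed_payoff A B (\<lambda>_ _. r) \<mu> \<nu> \<le> v"
      using \<nu> by (metis matrix_value_less_obtains)
    then show "r \<le> v"
      using mixed_payoff_const[OF _ \<nu>] by metis
  qed
qed

lemma matrix_value_scale_le:
  assumes "r > 0"
  shows "matrix_value A B (\<lambda>a b. r * Q a b) \<le> r * matrix_value A B Q"
proof (rule dense_ge)
  fix v assume "r * matrix_value A B Q < v"
  then have "matrix_value A B Q < v / r"
    using assms by (simp add: field_simps)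
  then obtain \<mu> where \<mu>: "set_pmf \<mu> \<subseteq> A"
    and le: "\<And>\<nu>. set_pmf \<nu> \<subseteq> B \<Longrightarrow> mixed_payoff A B Q \<mu> \<nu> \<le> v / r"
    by (metis matrix_value_less_obtains)
  show "matrix_value A B (\<lambda>a b. r * Q a b) \<le> v"
    using le assms by (intro matrix_value_le[OF \<mu>]) (auto simp: mixed_payoff_scale field_simps)
qed

lemma matrix_value_scale:
  assumes "r > 0"
  shows "matrix_value A B (\<lambda>a b. r * Q a b) = r * matrix_value A B Q"
proof (rule antisym)
  show "r * matrix_value A B Q \<le> matrix_value A B (\<lambda>a b. r * Q a b)"
    using matrix_value_scale_le[of "1 / r" "\<lambda>a b. r * Q a b"] assms by (simp add: field_simps)
qed (rule matrix_value_scale_le[OF assms])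

text \<open>
Von Neumann's minimax theorem, for a level \<open>v\<close> strictly below the value. The vectors that are
coordinatewise at most \<open>v\<close> on \<open>B\<close> form a convex set \<open>S\<close>; those that dominate the column payoffs of
some mixed strategy of the minimiser form a convex set \<open>T\<close>. They are disjoint because the value
exceeds \<open>v\<close>, and a normal vector of a separating hyperplane, scaled to total mass one, is the
desired strategy of the maximiser. Coordinates outside \<open>B\<close> are unconstrained in both sets, which
forces the normal vector to vanish there.
\<close>

lemma matrix_minimax:
  assumes "v < matrix_value A B Q"
  obtains \<nu> where "set_pmf \<nu> \<subseteq> B" "\<And>\<mu>. set_pmf \<mu> \<subseteq> A \<Longrightarrow> v \<le> mixed_payoff A B Q \<mu> \<nu>"
proof -
  define S where "S = {y :: real ^ 'b. \<forall>b\<in>B. y $ b \<le> v}"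
  define T where "T = {y :: real ^ 'b. \<exists>\<mu>. set_pmf \<mu> \<subseteq> A \<and> (\<forall>b\<in>B. (\<Sum>a\<in>A. Q a b * pmf \<mu> a) \<le> y $ b)}"
  have payoff: "mixed_payoff A B Q \<mu> \<nu> = (\<Sum>b\<in>B. pmf \<nu> b * (\<Sum>a\<in>A. Q a b * pmf \<mu> a))" for \<mu> \<nu>
    unfolding mixed_payoff_def by (subst sum.swap) (simp add: sum_distrib_left mult_ac)
  have "convex S"
    unfolding S_def convex_alt using convex_bound_le[of _ v _] by auto
  have "convex T"
    unfolding convex_alt
  proof (intro ballI allI impI)
    fix y z :: "real ^ 'b" and u :: real
    assume "y \<in> T" "z \<in> T" and u: "0 \<le> u \<and> u \<le> 1"
    then obtain \<mu> \<mu>' where \<mu>: "set_pmf \<mu> \<subseteq> A" "\<And>b. b \<in> B \<Longrightarrow> (\<Sum>a\<in>A. Q a b * pmf \<mu> a) \<le> y $ b"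
      and \<mu>': "set_pmf \<mu>' \<subseteq> A" "\<And>b. b \<in> B \<Longrightarrow> (\<Sum>a\<in>A. Q a b * pmf \<mu>' a) \<le> z $ b"
      unfolding T_def by blast
    define \<kappa> where "\<kappa> = bind_pmf (bernoulli_pmf u) (\<lambda>t. if t then \<mu>' else \<mu>)"
    have "pmf \<kappa> a = (1 - u) * pmf \<mu> a + u * pmf \<mu>' a" for a
      using u by (simp add: \<kappa>_def pmf_bind)
    then have "(\<Sum>a\<in>A. Q a b * pmf \<kappa> a) =
        (1 - u) * (\<Sum>a\<in>A. Q a b * pmf \<mu> a) + u * (\<Sum>a\<in>A. Q a b * pmf \<mu>' a)" for b
      by (simp only: sum_distrib_left flip: sum.distrib) (simp add: algebra_simps)
    then have "\<forall>b\<in>B. (\<Sum>a\<in>A. Q a b * pmf \<kappa> a) \<le> ((1 - u) *\<^sub>R y + u *\<^sub>R z) $ b"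
      using u \<mu>(2) \<mu>'(2) by (auto intro!: add_mono mult_left_mono)
    moreover have "set_pmf \<kappa> \<subseteq> A"
      using \<mu>(1) \<mu>'(1) by (auto simp: \<kappa>_def split: if_splits)
    ultimately show "(1 - u) *\<^sub>R y + u *\<^sub>R z \<in> T"
      unfolding T_def by blast
  qed
  have "S \<inter> T = {}"
  proof (rule ccontr)
    assume "S \<inter> T \<noteq> {}"
    then obtain y \<mu> where y: "\<And>b. b \<in> B \<Longrightarrow> y $ b \<le> v" and \<mu>: "set_pmf \<mu> \<subseteq> A"
      and le: "\<And>b. b \<in> B \<Longrightarrow> (\<Sum>a\<in>A. Q a b * pmf \<mu> a) \<le> y $ b"
      unfolding S_def T_def by blast
    have "matrix_value A B Q \<le> v"
    proof (rule matrix_value_le[OF \<mu>])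
      fix \<nu> assume \<nu>: "set_pmf \<nu> \<subseteq> B"
      have "mixed_payoff A B Q \<mu> \<nu> \<le> (\<Sum>b\<in>B. pmf \<nu> b * v)"
        unfolding payoff using order_trans[OF le y] by (intro sum_mono mult_left_mono) auto
      also have "\<dots> = v"
        using \<nu> by (simp add: sum_pmf_eq_1 flip: sum_distrib_right)
      finally show "mixed_payoff A B Q \<mu> \<nu> \<le> v" .
    qed
    then show False
      using assms by simp
  qed
  moreover have "(\<chi> b. v) \<in> S"
    by (simp add: S_def)
  moreover have T_I: "(\<chi> b. \<Sum>a\<in>A. Q a b * pmf \<mu> a) \<in> T" if "set_pmf \<mu> \<subseteq> A" for \<mu>
    using that by (auto simp: T_def)
  then have "T \<noteq> {}"
    using pmf_supported_exists[OF A_ne] by blast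
  ultimately obtain c :: "real ^ 'b" and d
    where "c \<noteq> 0" and S: "\<And>y. y \<in> S \<Longrightarrow> c \<bullet> y \<le> d" and T: "\<And>y. y \<in> T \<Longrightarrow> d \<le> c \<bullet> y"
    using separating_hyperplane_sets[OF \<open>convex S\<close> \<open>convex T\<close>] by blast
  \<comment> \<open>Moving the constant vector \<open>v\<close> along a coordinate axis inside \<open>S\<close> fixes the signs of \<open>c\<close>.\<close>
  have shift: "(\<Sum>b\<in>UNIV. c $ b * v) + s * c $ b0 \<le> d" if "b0 \<in> B \<longrightarrow> s \<le> 0" for s b0
  proof -
    have "(\<chi> b. v + (if b = b0 then s else 0)) \<in> S"
      using that by (auto simp: S_def)
    from S[OF this] show ?thesis
      by (simp add: inner_vec_def algebra_simps sum.distrib if_distrib[where f = "(*) _"] cong: if_cong)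
  qed
  have nonneg: "0 \<le> c $ b" for b
  proof -
    have "- c $ b \<le> 0"
      using shift[of b "- _"] by (intro nonpos_if_affine_bounded) auto
    then show ?thesis
      by simp
  qed
  have zero: "c $ b = 0" if "b \<notin> B" for b
  proof -
    have "c $ b \<le> 0"
      using shift[of b] that by (intro nonpos_if_affine_bounded) auto
    then show ?thesis
      using nonneg[of b] by simp
  qed
  define Z where "Z = (\<Sum>b\<in>UNIV. c $ b)"
  obtain b where "c $ b \<noteq> 0"
    using \<open>c \<noteq> 0\<close> by (auto simp: vec_eq_iff)
  then have "Z > 0"
    unfolding Z_def using nonneg by (intro sum_pos2[where i = b]) (auto simp: less_le)
  define \<nu> where "\<nu> = embed_pmf (\<lambda>b. c $ b / Z)"
  have total: "(\<integral>\<^sup>+b. ennreal (c $ b / Z) \<partial>count_space UNIV) = 1"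
    using \<open>Z > 0\<close> nonneg
    by (simp add: nn_integral_count_space_finite sum_ennreal Z_def flip: sum_divide_distrib)
  have \<nu>: "pmf \<nu> b = c $ b / Z" for b
    unfolding \<nu>_def using total nonneg \<open>Z > 0\<close> by (intro pmf_embed_pmf) auto
  have "set_pmf \<nu> \<subseteq> B"
  proof
    fix b assume "b \<in> set_pmf \<nu>"
    then have "c $ b \<noteq> 0"
      by (simp add: set_pmf_iff \<nu>)
    then show "b \<in> B"
      using zero by blast
  qed
  moreover have "v \<le> mixed_payoff A B Q \<mu> \<nu>" if "set_pmf \<mu> \<subseteq> A" for \<mu>
  proof -
    have "Z * v \<le> d"
      using shift[of undefined 0] by (simp add: Z_def sum_distrib_right)
    also have "d \<le> (\<Sum>b\<in>UNIV. c $ b * (\<Sum>a\<in>A. Q a b * pmf \<mu> a))"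
      using T[OF T_I[OF that]] by (simp add: inner_vec_def)
    also have "\<dots> = (\<Sum>b\<in>B. c $ b * (\<Sum>a\<in>A. Q a b * pmf \<mu> a))"
      using zero by (intro sum.mono_neutral_right) auto
    also have "\<dots> = Z * mixed_payoff A B Q \<mu> \<nu>"
      using \<open>Z > 0\<close> by (simp add: payoff \<nu> sum_distrib_left)
    finally show ?thesis
      using \<open>Z > 0\<close> by simp
  qed
  ultimately show thesis
    by (rule that)
qed

end

section \<open>The one-step operator and its iterates\<close>

definition one_step ::
  "('s::finite, 'a::finite, 'b::finite) game \<Rightarrow> ('s \<Rightarrow> real) \<Rightarrow> 's \<Rightarrow> 'a \<Rightarrow> 'b \<Rightarrow> real" where
  "one_step G h x a b = exp (risk G * cost G x a b) * (\<Sum>j\<in>UNIV. h j * pmf (trans G x a b) j)"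

lemma L_op_eq_matrix_value:
  "L_op G h x = matrix_value (act1 G x) (act2 G x) (one_step G h x)"
  by (simp add: L_op_def matrix_value_def mixed_payoff_def one_step_def
      sum_distrib_left sum_distrib_right mult.assoc)

lemma one_step_mono: "(\<And>j. h j \<le> h' j) \<Longrightarrow> one_step G h x a b \<le> one_step G h' x a b"
  by (auto simp: one_step_def intro!: mult_left_mono sum_mono mult_right_mono)

lemma one_step_scale: "one_step G (\<lambda>j. r * h j) x a b = r * one_step G h x a b"
  by (simp add: one_step_def sum_distrib_left mult.assoc mult.left_commute)

lemma one_step_one: "one_step G (\<lambda>_. 1) x a b = exp (risk G * cost G x a b)"
  by (simp add: one_step_def sum_pmf_eq_1)

abbreviation iter_one :: "('s::finite, 'a::finite, 'b::finite) game \<Rightarrow> nat \<Rightarrow> 's \<Rightarrow> real" where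
  "iter_one G n \<equiv> (L_op G ^^ n) (\<lambda>_. 1)"

lemma exists_min_transition_probability:
  fixes G :: "('s::finite, 'a::finite, 'b::finite) game"
  shows "\<exists>p>0. \<forall>x a b. \<forall>j\<in>set_pmf (trans G x a b). p \<le> pmf (trans G x a b) j"
proof -
  let ?S = "insert 1 ((\<lambda>(x, a, b, j). pmf (trans G x a b) j) ` {(x, a, b, j). j \<in> set_pmf (trans G x a b)})"
  have "0 < Min ?S"
    by (auto simp: pmf_positive)
  moreover have "Min ?S \<le> pmf (trans G x a b) j" if "j \<in> set_pmf (trans G x a b)" for x a b j
    using that by (intro Min_le insertI2 image_eqI[where x = "(x, a, b, j)"]) auto
  ultimately show ?thesis
    by blast
qed

text \<open>
A joint trap is a proper nonempty set of states that the two players can cooperate to never leave.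
Such a set can be kept by deterministic stationary choices, so the irreducibility condition on all
deterministic stationary pairs excludes it; its absence is the only form in which irreducibility
is used.
\<close>

definition no_joint_trap :: "('s::finite, 'a::finite, 'b::finite) game \<Rightarrow> bool" where
  "no_joint_trap G \<longleftrightarrow> (\<forall>S. S \<noteq> {} \<longrightarrow> S \<noteq> UNIV \<longrightarrow>
     (\<exists>x\<in>S. \<forall>a\<in>act1 G x. \<forall>b\<in>act2 G x. \<not> set_pmf (trans G x a b) \<subseteq> S))"

text \<open>
The time and the constant are chosen before the function, because one choice has to serve all
iterates of one.
\<close>

definition harnack_bound ::
  "('s::finite, 'a::finite, 'b::finite) game \<Rightarrow> nat \<Rightarrow> real \<Rightarrow> 's \<Rightarrow> 's \<Rightarrow> bool" where
  "harnack_bound G t \<epsilon> x y \<longleftrightarrow>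
    (\<forall>w. (\<forall>x. 0 \<le> w x) \<longrightarrow> (\<forall>x. w x \<le> L_op G w x) \<longrightarrow> \<epsilon> * w y \<le> (L_op G ^^ t) w x)"

context
  fixes G :: "('s::finite, 'a::finite, 'b::finite) game"
  assumes game: "risk_game G"
begin

lemma risk_pos: "0 < risk G"
  and act1_ne: "act1 G x \<noteq> {}"
  and act2_ne: "act2 G x \<noteq> {}"
  and cost_nonneg: "a \<in> act1 G x \<Longrightarrow> b \<in> act2 G x \<Longrightarrow> 0 \<le> cost G x a b"
  using game by (auto simp: risk_game_def adm_def)

lemma L_op_mono:
  assumes "\<And>j. h j \<le> h' j"
  shows "L_op G h x \<le> L_op G h' x"
  unfolding L_op_eq_matrix_value
  by (intro matrix_value_mono act1_ne act2_ne one_step_mono assms)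

lemma L_op_scale: "r > 0 \<Longrightarrow> L_op G (\<lambda>j. r * h j) x = r * L_op G h x"
  by (simp add: L_op_eq_matrix_value matrix_value_scale[OF act1_ne act2_ne] one_step_scale[abs_def])

lemma L_op_ge:
  assumes "\<And>a b. a \<in> act1 G x \<Longrightarrow> b \<in> act2 G x \<Longrightarrow> r \<le> one_step G h x a b"
  shows "r \<le> L_op G h x"
proof -
  have "r = matrix_value (act1 G x) (act2 G x) (\<lambda>_ _. r)"
    by (simp add: matrix_value_const act1_ne act2_ne)
  also have "\<dots> \<le> matrix_value (act1 G x) (act2 G x) (one_step G h x)"
    by (intro matrix_value_mono act1_ne act2_ne assms)
  finally show ?thesis
    by (simp add: L_op_eq_matrix_value)
qed

lemma iterate_mono: "(\<And>j. h j \<le> h' j) \<Longrightarrow> (L_op G ^^ n) h x \<le> (L_op G ^^ n) h' x"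
  by (induction n arbitrary: x) (auto intro: L_op_mono)

lemma iterate_scale: "r > 0 \<Longrightarrow> (L_op G ^^ n) (\<lambda>j. r * h j) x = r * (L_op G ^^ n) h x"
proof (induction n arbitrary: x)
  case (Suc n)
  then have "(L_op G ^^ n) (\<lambda>j. r * h j) = (\<lambda>y. r * (L_op G ^^ n) h y)"
    by blast
  then show ?case
    using Suc.prems by (simp add: L_op_scale)
qed simp

lemma one_le_exp_cost:
  "a \<in> act1 G x \<Longrightarrow> b \<in> act2 G x \<Longrightarrow> 1 \<le> exp (risk G * cost G x a b)"
  using cost_nonneg[of a x b] risk_pos by simp

text \<open>
Nonnegativity of the costs enters here: one more stage never decreases the exponential cost. This
makes the iterates admissible in the Harnack inequality.
\<close>

lemma iter_one_Suc_ge: "iter_one G n x \<le> iter_one G (Suc n) x"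
proof -
  have "1 \<le> L_op G (\<lambda>_. 1) j" for j
    by (rule L_op_ge) (simp only: one_step_one one_le_exp_cost)
  then have "iter_one G n x \<le> (L_op G ^^ n) (L_op G (\<lambda>_. 1)) x"
    by (rule iterate_mono)
  then show ?thesis
    by (simp add: funpow_swap1)
qed

lemma iter_one_ge_1: "1 \<le> iter_one G n x"
proof (induction n)
  case (Suc n)
  then show ?case
    using iter_one_Suc_ge[of n x] by linarith
qed simp

lemma Max_iter_one_ge: "iter_one G n x \<le> (MAX x. iter_one G n x)"
  by simp

lemma Min_iter_one_le: "(MIN x. iter_one G n x) \<le> iter_one G n x"
  by simp

lemma Min_iter_one_ge_1: "1 \<le> (MIN x. iter_one G n x)"
  using iter_one_ge_1 by simp

lemma Min_le_Max_iter_one: "(MIN x. iter_one G n x) \<le> (MAX x. iter_one G n x)"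
  using Min_iter_one_le Max_iter_one_ge by (rule order_trans)

text \<open>
Monotonicity and positive homogeneity make the maximum over the states submultiplicative in the
number of stages, and the minimum supermultiplicative.
\<close>

lemma iter_one_add_le: "iter_one G (m + n) x \<le> (MAX y. iter_one G n y) * iter_one G m x"
proof -
  have pos: "0 < (MAX y. iter_one G n y)"
    using Min_le_Max_iter_one[of n] Min_iter_one_ge_1[of n] by linarith
  have "iter_one G (m + n) x = (L_op G ^^ m) (iter_one G n) x"
    by (simp add: funpow_add)
  also have "\<dots> \<le> (L_op G ^^ m) (\<lambda>_. (MAX y. iter_one G n y) * 1) x"
    by (rule iterate_mono) simp
  also have "\<dots> = (MAX y. iter_one G n y) * iter_one G m x"
    by (rule iterate_scale[OF pos])
  finally show ?thesis .
qed

lemma iter_one_add_ge: "(MIN y. iter_one G n y) * iter_one G m x \<le> iter_one G (m + n) x"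
proof -
  have pos: "0 < (MIN y. iter_one G n y)"
    using Min_iter_one_ge_1[of n] by linarith
  have "(MIN y. iter_one G n y) * iter_one G m x = (L_op G ^^ m) (\<lambda>_. (MIN y. iter_one G n y) * 1) x"
    by (rule iterate_scale[OF pos, symmetric])
  also have "\<dots> \<le> (L_op G ^^ m) (iter_one G n) x"
    by (rule iterate_mono) simp
  also have "\<dots> = iter_one G (m + n) x"
    by (simp add: funpow_add)
  finally show ?thesis .
qed

lemma Max_iter_one_double: "(MAX x. iter_one G (2 * n) x) \<le> (MAX x. iter_one G n x) ^ 2"
proof -
  have "iter_one G (2 * n) x \<le> (MAX x. iter_one G n x) ^ 2" for x
  proof -
    have "iter_one G (2 * n) x \<le> (MAX y. iter_one G n y) * iter_one G n x"
      using iter_one_add_le[of n n x] by (simp add: mult_2)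
    also have "\<dots> \<le> (MAX y. iter_one G n y) * (MAX y. iter_one G n y)"
      using Min_le_Max_iter_one[of n] Min_iter_one_ge_1[of n] by (intro mult_left_mono Max_iter_one_ge) linarith
    finally show ?thesis
      by (simp add: power2_eq_square)
  qed
  then show ?thesis
    by simp
qed

lemma Min_iter_one_double: "(MIN x. iter_one G n x) ^ 2 \<le> (MIN x. iter_one G (2 * n) x)"
proof -
  have "(MIN x. iter_one G n x) ^ 2 \<le> iter_one G (2 * n) x" for x
  proof -
    have "(MIN y. iter_one G n y) * (MIN y. iter_one G n y) \<le> (MIN y. iter_one G n y) * iter_one G n x"
      using Min_iter_one_ge_1[of n] by (intro mult_left_mono Min_iter_one_le) linarith
    also have "\<dots> \<le> iter_one G (2 * n) x"
      using iter_one_add_ge[of n n x] by (simp add: mult_2)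
    finally show ?thesis
      by (simp add: power2_eq_square)
  qed
  then show ?thesis
    by simp
qed

section \<open>A Harnack inequality from irreducibility\<close>

lemma one_step_ge_hit:
  assumes ab: "a \<in> act1 G x" "b \<in> act2 G x" and w: "\<And>j. 0 \<le> w j"
    and j: "p \<le> pmf (trans G x a b) j" "r \<le> w j" "0 \<le> p" "0 \<le> r"
  shows "p * r \<le> one_step G w x a b"
proof -
  have "p * r \<le> w j * pmf (trans G x a b) j"
    using j mult_mono[of p "pmf (trans G x a b) j" r "w j"] by (simp add: mult.commute)
  also have "\<dots> \<le> (\<Sum>j\<in>UNIV. w j * pmf (trans G x a b) j)"
    using w by (intro member_le_sum[where f = "\<lambda>j. w j * pmf (trans G x a b) j"]) auto
  also have "\<dots> \<le> one_step G w x a b"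
    unfolding one_step_def using mult_right_mono[OF one_le_exp_cost[OF ab], of "\<Sum>j\<in>UNIV. w j * pmf (trans G x a b) j"] w
    by (simp add: sum_nonneg)
  finally show ?thesis .
qed

lemma iterate_incr:
  assumes "\<And>x. w x \<le> L_op G w x" "s \<le> t"
  shows "(L_op G ^^ s) w x \<le> (L_op G ^^ t) w x"
  using \<open>s \<le> t\<close>
proof (induction t rule: dec_induct)
  case (step t)
  have "(L_op G ^^ t) w x \<le> (L_op G ^^ t) (L_op G w) x"
    by (intro iterate_mono assms)
  then show ?case
    using step by (simp add: funpow_swap1)
qed simp

text \<open>
Fix \<open>y\<close> and let \<open>S\<close> be the set of states \<open>x\<close> with such a bound; it contains \<open>y\<close>. If it were
not everything, then its complement would not be a joint trap, so some state outside \<open>S\<close> would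
enter \<open>S\<close> with a transition probability at least \<open>p\<close>, whatever actions the players choose. One more
step, at the price of a factor \<open>p\<close>, then gives a bound at that state too.
\<close>

lemma harnack_at:
  assumes trap: "no_joint_trap G"
  shows "\<exists>t \<epsilon>. 0 < \<epsilon> \<and> harnack_bound G t \<epsilon> x y"
proof -
  define S where "S = {x. \<exists>t \<epsilon>. 0 < \<epsilon> \<and> harnack_bound G t \<epsilon> x y}"
  have "S = UNIV"
  proof (rule ccontr)
    assume "S \<noteq> UNIV"
    have "harnack_bound G 0 1 y y"
      by (simp add: harnack_bound_def)
    then have "y \<in> S"
      unfolding S_def using zero_less_one by blast
    have "\<exists>t \<epsilon>. 0 < \<epsilon> \<and> harnack_bound G t \<epsilon> j y" if "j \<in> S" for j
      using that by (simp add: S_def)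
    then obtain t \<epsilon> where pos: "\<And>j. j \<in> S \<Longrightarrow> 0 < \<epsilon> j" and good: "\<And>j. j \<in> S \<Longrightarrow> harnack_bound G (t j) (\<epsilon> j) j y"
      by metis
    define T where "T = Max (t ` S)"
    define e where "e = Min (\<epsilon> ` S)"
    have "0 < e"
      unfolding e_def using pos \<open>y \<in> S\<close> by (subst Min_gr_iff) auto
    \<comment> \<open>Since \<open>w\<close> does not decrease under the operator, all bounds on \<open>S\<close> may be taken at the largest time.\<close>
    have unif: "e * w y \<le> (L_op G ^^ T) w j"
      if "j \<in> S" and w: "\<And>x. 0 \<le> w x" "\<And>x. w x \<le> L_op G w x" for j w
    proof -
      have "e * w y \<le> \<epsilon> j * w y"
        unfolding e_def using that by (intro mult_right_mono) auto
      also have "\<dots> \<le> (L_op G ^^ t j) w j"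
        using good[OF \<open>j \<in> S\<close>] w by (auto simp: harnack_bound_def)
      also have "\<dots> \<le> (L_op G ^^ T) w j"
        using \<open>j \<in> S\<close> by (intro iterate_incr w) (auto simp: T_def)
      finally show ?thesis .
    qed
    obtain p where p: "0 < p" and p_le: "\<And>x a b j. j \<in> set_pmf (trans G x a b) \<Longrightarrow> p \<le> pmf (trans G x a b) j"
      using exists_min_transition_probability by blast
    obtain x where "x \<notin> S"
      and hit: "\<And>a b. a \<in> act1 G x \<Longrightarrow> b \<in> act2 G x \<Longrightarrow> \<not> set_pmf (trans G x a b) \<subseteq> - S"
      using trap[unfolded no_joint_trap_def, rule_format, of "- S"] \<open>y \<in> S\<close> \<open>S \<noteq> UNIV\<close> by blast
    have "p * e * w y \<le> (L_op G ^^ Suc T) w x"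
      if w: "\<And>x. 0 \<le> w x" "\<And>x. w x \<le> L_op G w x" for w
    proof -
      have "p * (e * w y) \<le> L_op G ((L_op G ^^ T) w) x"
      proof (rule L_op_ge)
        fix a b assume ab: "a \<in> act1 G x" "b \<in> act2 G x"
        then obtain j where j: "j \<in> set_pmf (trans G x a b)" "j \<in> S"
          using hit by blast
        have "0 \<le> (L_op G ^^ T) w j'" for j'
          using order_trans[OF w(1) iterate_incr[OF w(2), of 0 T, simplified]] .
        then show "p * (e * w y) \<le> one_step G ((L_op G ^^ T) w) x a b"
          using ab p_le[OF j(1)] unif[OF j(2) w] p \<open>0 < e\<close> w(1)[of y]
          by (intro one_step_ge_hit) auto
      qed
      then show ?thesis
        by (simp add: mult.assoc)
    qed
    then have "harnack_bound G (Suc T) (p * e) x y"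
      unfolding harnack_bound_def by blast
    then have "x \<in> S"
      unfolding S_def using mult_pos_pos[OF p \<open>0 < e\<close>] by blast
    then show False
      using \<open>x \<notin> S\<close> by blast
  qed
  then have "x \<in> S"
    by simp
  then show ?thesis
    unfolding S_def by blast
qed

lemma harnack:
  assumes "no_joint_trap G"
  shows "\<exists>t \<epsilon>. 0 < \<epsilon> \<and> (\<forall>x y. harnack_bound G t \<epsilon> x y)"
proof -
  obtain t \<epsilon> where pos: "\<And>x y. 0 < \<epsilon> x y" and good: "\<And>x y. harnack_bound G (t x y) (\<epsilon> x y) x y"
    using harnack_at[OF assms] by metis
  define T where "T = Max (range (\<lambda>(x, y). t x y))"
  define e where "e = Min (range (\<lambda>(x, y). \<epsilon> x y))"
  have "0 < e"
    unfolding e_def using pos by (subst Min_gr_iff) auto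
  moreover have "e * w y \<le> (L_op G ^^ T) w x"
    if w: "\<And>x. 0 \<le> w x" "\<And>x. w x \<le> L_op G w x" for w x y
  proof -
    have "e \<le> \<epsilon> x y" "t x y \<le> T"
      unfolding e_def T_def by (force intro: Min_le Max_ge)+
    have "e * w y \<le> \<epsilon> x y * w y"
      using \<open>e \<le> \<epsilon> x y\<close> w by (intro mult_right_mono)
    also have "\<dots> \<le> (L_op G ^^ t x y) w x"
      using good[of x y] w by (auto simp: harnack_bound_def)
    also have "\<dots> \<le> (L_op G ^^ T) w x"
      by (rule iterate_incr[OF w(2) \<open>t x y \<le> T\<close>])
    finally show ?thesis .
  qed
  ultimately show ?thesis
    unfolding harnack_bound_def by blast
qed

text \<open>
The Harnack inequality compares the maximum of the \<open>n\<close>-th iterate with the minimum of the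
\<open>(n + t)\<close>-th one, and submultiplicativity bounds the effect of the \<open>t\<close> additional steps uniformly
in \<open>n\<close>.
\<close>

lemma Max_Min_iter_one_comparable:
  assumes "no_joint_trap G"
  obtains C where "0 < C" "\<And>n. (MAX x. iter_one G n x) \<le> C * (MIN x. iter_one G n x)"
proof -
  obtain t \<epsilon> where "0 < \<epsilon>" and bound: "\<And>x y. harnack_bound G t \<epsilon> x y"
    using harnack[OF assms] by blast
  define C where "C = (MAX x. iter_one G t x) / \<epsilon>"
  have "0 < (MAX x. iter_one G t x)"
    using Min_le_Max_iter_one[of t] Min_iter_one_ge_1[of t] by linarith
  then have "0 < C"
    using \<open>0 < \<epsilon>\<close> by (simp add: C_def)
  moreover have "(MAX x. iter_one G n x) \<le> C * (MIN x. iter_one G n x)" for n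
  proof -
    have "iter_one G n y \<le> C * iter_one G n x" for x y
    proof -
      have "0 \<le> iter_one G n x" "iter_one G n x \<le> L_op G (iter_one G n) x" for x
        using iter_one_ge_1[of n x] iter_one_Suc_ge[of n x] by simp_all
      then have "\<epsilon> * iter_one G n y \<le> (L_op G ^^ t) (iter_one G n) x"
        using bound[of x y] by (simp add: harnack_bound_def)
      also have "\<dots> = iter_one G (n + t) x"
        by (simp add: funpow_add add.commute[of n])
      also have "\<dots> \<le> (MAX y. iter_one G t y) * iter_one G n x"
        by (rule iter_one_add_le)
      finally show ?thesis
        using \<open>0 < \<epsilon>\<close> by (simp add: C_def field_simps)
    qed
    moreover have "(MAX x. iter_one G n x) \<in> range (iter_one G n)"
      by (rule Max_in) auto
    then obtain y where "(MAX x. iter_one G n x) = iter_one G n y" ..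
    moreover have "(MIN x. iter_one G n x) \<in> range (iter_one G n)"
      by (rule Min_in) auto
    then obtain x where "(MIN x. iter_one G n x) = iter_one G n x" ..
    ultimately show ?thesis
      by simp
  qed
  ultimately show thesis
    by (rule that)
qed

section \<open>Positive super- and subharmonic functions\<close>

text \<open>
A bound on a single iterate already yields an exact supersolution: the minimum of the first \<open>N\<close>
iterates, rescaled by powers of \<open>\<kappa>\<close>. The operator shifts the index by one, and the assumption on
the \<open>N\<close>-th iterate closes the cycle. Thus \<open>h\<close> takes the role that an
eigenfunction of the operator would have.
\<close>

lemma superharmonic_exists:
  assumes "0 < N" "0 < \<kappa>" and top: "\<And>x. iter_one G N x \<le> \<kappa> ^ N"
  obtains h where "\<And>x. 0 < h x" "\<And>x. L_op G h x \<le> \<kappa> * h x"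
proof -
  define h where "h x = (MIN k\<in>{..<N}. (1 / \<kappa> ^ k) * iter_one G k x)" for x
  have iter_pos: "0 < iter_one G k x" for k x
    using iter_one_ge_1[of k x] by linarith
  have h_le: "h x \<le> (1 / \<kappa> ^ k) * iter_one G k x" if "k < N" for k x
    unfolding h_def using that by (intro Min_le) auto
  have Lh_le: "L_op G h x \<le> (1 / \<kappa> ^ k) * iter_one G (Suc k) x" if "k < N" for k x
  proof -
    have "L_op G h x \<le> L_op G (\<lambda>y. (1 / \<kappa> ^ k) * iter_one G k y) x"
      using h_le[OF that] by (rule L_op_mono)
    also have "\<dots> = (1 / \<kappa> ^ k) * iter_one G (Suc k) x"
      using \<open>0 < \<kappa>\<close> by (subst L_op_scale) auto
    finally show ?thesis .
  qed
  have "L_op G h x \<le> \<kappa> * h x" for x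
  proof -
    have "h x \<in> (\<lambda>k. (1 / \<kappa> ^ k) * iter_one G k x) ` {..<N}"
      unfolding h_def using \<open>0 < N\<close> by (intro Min_in) auto
    then obtain k where "k < N" and k: "h x = (1 / \<kappa> ^ k) * iter_one G k x"
      by auto
    show ?thesis
    proof (cases k)
      case 0
      \<comment> \<open>No smaller index is left, so the bound comes from the other end of the cycle.\<close>
      have "L_op G h x \<le> (1 / \<kappa> ^ (N - 1)) * iter_one G (Suc (N - 1)) x"
        using \<open>0 < N\<close> by (intro Lh_le) auto
      also have "\<dots> \<le> (1 / \<kappa> ^ (N - 1)) * \<kappa> ^ N"
        using \<open>0 < \<kappa>\<close> \<open>0 < N\<close> top[of x] by (intro mult_left_mono) auto
      also have "\<dots> = \<kappa>"
        using \<open>0 < \<kappa>\<close> \<open>0 < N\<close> by (cases N) simp_all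
      finally show ?thesis
        using 0 k by simp
    next
      case (Suc l)
      then have "L_op G h x \<le> (1 / \<kappa> ^ l) * iter_one G k x"
        using Lh_le[of l x] \<open>k < N\<close> by simp
      then show ?thesis
        using Suc k \<open>0 < \<kappa>\<close> by simp
    qed
  qed
  moreover have "0 < h x" for x
    unfolding h_def using \<open>0 < N\<close> \<open>0 < \<kappa>\<close> iter_pos by (subst Min_gr_iff) auto
  ultimately show thesis
    by (rule that[rotated])
qed

text \<open>
The same construction with the maximum in place of the minimum.
\<close>

lemma subharmonic_exists:
  assumes "0 < N" "0 < \<kappa>" and bot: "\<And>x. \<kappa> ^ N \<le> iter_one G N x"
  obtains h where "\<And>x. 0 < h x" "\<And>x. \<kappa> * h x \<le> L_op G h x"
proof -
  define h where "h x = (MAX k\<in>{..<N}. (1 / \<kappa> ^ k) * iter_one G k x)" for x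
  have iter_pos: "0 < iter_one G k x" for k x
    using iter_one_ge_1[of k x] by linarith
  have h_ge: "(1 / \<kappa> ^ k) * iter_one G k x \<le> h x" if "k < N" for k x
    unfolding h_def using that by (intro Max_ge) auto
  have Lh_ge: "(1 / \<kappa> ^ k) * iter_one G (Suc k) x \<le> L_op G h x" if "k < N" for k x
  proof -
    have "(1 / \<kappa> ^ k) * iter_one G (Suc k) x = L_op G (\<lambda>y. (1 / \<kappa> ^ k) * iter_one G k y) x"
      using \<open>0 < \<kappa>\<close> by (subst L_op_scale) auto
    also have "\<dots> \<le> L_op G h x"
      using h_ge[OF that] by (rule L_op_mono)
    finally show ?thesis .
  qed
  have "\<kappa> * h x \<le> L_op G h x" for x
  proof -
    have "h x \<in> (\<lambda>k. (1 / \<kappa> ^ k) * iter_one G k x) ` {..<N}"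
      unfolding h_def using \<open>0 < N\<close> by (intro Max_in) auto
    then obtain k where "k < N" and k: "h x = (1 / \<kappa> ^ k) * iter_one G k x"
      by auto
    show ?thesis
    proof (cases k)
      case 0
      have "\<kappa> = (1 / \<kappa> ^ (N - 1)) * \<kappa> ^ N"
        using \<open>0 < \<kappa>\<close> \<open>0 < N\<close> by (cases N) simp_all
      also have "\<dots> \<le> (1 / \<kappa> ^ (N - 1)) * iter_one G (Suc (N - 1)) x"
        using \<open>0 < \<kappa>\<close> \<open>0 < N\<close> bot[of x] by (intro mult_left_mono) auto
      also have "\<dots> \<le> L_op G h x"
        using \<open>0 < N\<close> by (intro Lh_ge) auto
      finally show ?thesis
        using 0 k by simp
    next
      case (Suc l)
      then have "(1 / \<kappa> ^ l) * iter_one G k x \<le> L_op G h x"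
        using Lh_ge[of l x] \<open>k < N\<close> by simp
      then show ?thesis
        using Suc k \<open>0 < \<kappa>\<close> by simp
    qed
  qed
  moreover have "0 < h x" for x
    using h_ge[of 0 x] \<open>0 < N\<close> by simp
  ultimately show thesis
    by (rule that[rotated])
qed

end

section \<open>The law of finite histories\<close>

text \<open>
The exponential cost of \<open>n\<close> stages depends only on the first \<open>n\<close> coordinates. Their law has finite
support, so expectations become finite sums and the recursion allows induction over the stages.
\<close>

primrec play_pmf ::
  "('s::finite, 'a::finite, 'b::finite) game \<Rightarrow> 's \<Rightarrow> (nat \<Rightarrow> ('s, 'a, 'b) hist \<Rightarrow> 'a pmf) \<Rightarrow>
   (nat \<Rightarrow> ('s, 'a, 'b) hist \<Rightarrow> 'b pmf) \<Rightarrow> nat \<Rightarrow> ('s \<times> 'a \<times> 'b) list pmf" where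
  "play_pmf G i \<pi> \<sigma> 0 = return_pmf []"
| "play_pmf G i \<pi> \<sigma> (Suc n) =
     bind_pmf (play_pmf G i \<pi> \<sigma> n) (\<lambda>xs. map_pmf (\<lambda>z. xs @ [z]) (step_law G i \<pi> \<sigma> n ((!) xs)))"

lemma finite_set_play_pmf: "finite (set_pmf (play_pmf G i \<pi> \<sigma> n))"
  by (induction n) auto

lemma length_play_pmf: "xs \<in> set_pmf (play_pmf G i \<pi> \<sigma> n) \<Longrightarrow> length xs = n"
  by (induction n arbitrary: xs) auto

lemma pmf_map_snoc:
  "pmf (map_pmf (\<lambda>z. xs @ [z]) p) (ys @ [z]) = indicator {ys} xs * pmf p z"
proof (cases "xs = ys")
  case True
  then show ?thesis
    using pmf_map_inj'[of "\<lambda>z. ys @ [z]" p z] by (simp add: inj_on_def)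
next
  case False
  then have "ys @ [z] \<notin> set_pmf (map_pmf (\<lambda>z. xs @ [z]) p)"
    by auto
  then show ?thesis
    using False by (simp only: set_pmf_iff not_not) simp
qed

lemma pmf_play_pmf:
  "length xs = n \<Longrightarrow>
    pmf (play_pmf G i \<pi> \<sigma> n) xs = (\<Prod>k<n. pmf (step_law G i \<pi> \<sigma> k ((!) xs)) (xs ! k))"
proof (induction n arbitrary: xs)
  case (Suc n)
  then obtain ys z where xs: "xs = ys @ [z]" and ys: "length ys = n"
    by (metis length_Suc_conv_rev)
  have prefix: "step_law G i \<pi> \<sigma> k ((!) xs) = step_law G i \<pi> \<sigma> k ((!) ys)" if "k \<le> n" for k
    using that ys by (intro step_law_cong) (simp add: xs nth_append)
  have "pmf (play_pmf G i \<pi> \<sigma> (Suc n)) xs =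
      (\<integral>xs'. indicator {ys} xs' * pmf (step_law G i \<pi> \<sigma> n ((!) ys)) z \<partial>measure_pmf (play_pmf G i \<pi> \<sigma> n))"
    unfolding play_pmf.simps pmf_bind xs pmf_map_snoc
    by (intro Bochner_Integration.integral_cong) (auto split: split_indicator)
  also have "\<dots> = pmf (play_pmf G i \<pi> \<sigma> n) ys * pmf (step_law G i \<pi> \<sigma> n ((!) ys)) z"
    by (simp add: measure_pmf_single)
  also have "pmf (play_pmf G i \<pi> \<sigma> n) ys = (\<Prod>k<n. pmf (step_law G i \<pi> \<sigma> k ((!) xs)) (xs ! k))"
  proof -
    have "xs ! k = ys ! k" if "k < n" for k
      using that ys by (simp add: xs nth_append)
    then show ?thesis
      unfolding Suc.IH[OF ys] by (intro prod.cong) (simp_all add: prefix)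
  qed
  finally show ?case
    using ys by (simp add: prefix) (simp add: xs nth_append)
qed simp

lemma sets_play_law: "sets (play_law G i \<pi> \<sigma>) = sets (PiM UNIV (\<lambda>_. count_space UNIV))"
proof -
  interpret Ionescu_Tulcea "\<lambda>n \<omega>. measure_pmf (step_law G i \<pi> \<sigma> n \<omega>)" "\<lambda>_. count_space UNIV"
    by (rule Ionescu_Tulcea_step_law)
  show ?thesis
    unfolding play_law_def by simp
qed

lemma space_play_law: "space (play_law G i \<pi> \<sigma>) = UNIV"
  using sets_eq_imp_space_eq[OF sets_play_law] by (simp add: space_PiM)

lemma map_upt_eq_iff: "length xs = n \<Longrightarrow> map \<omega> [0..<n] = xs \<longleftrightarrow> (\<forall>k<n. \<omega> k = xs ! k)"
  by (auto simp: list_eq_iff_nth_eq)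

lemma measurable_prefix: "(\<lambda>\<omega>. map \<omega> [0..<n]) \<in> measurable (play_law G i \<pi> \<sigma>) (count_space UNIV)"
proof (subst measurable_count_space_eq2_countable, safe)
  fix xs :: "('a \<times> 'b \<times> 'c) list"
  have "{\<omega>. \<forall>k<n. \<omega> k = xs ! k} =
      {\<omega> \<in> space (PiM UNIV (\<lambda>_. count_space UNIV)). \<forall>k\<in>{..<n}. \<omega> k = xs ! k}"
    by (auto simp: space_PiM)
  also have "\<dots> \<in> sets (PiM UNIV (\<lambda>_. count_space UNIV))"
    by measurable
  finally have "{\<omega>. \<forall>k<n. \<omega> k = xs ! k} \<in> sets (play_law G i \<pi> \<sigma>)"
    by (simp only: sets_play_law)
  moreover have "(\<lambda>\<omega>. map \<omega> [0..<n]) -` {xs} = (if length xs = n then {\<omega>. \<forall>k<n. \<omega> k = xs ! k} else {})"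
    using map_upt_eq_iff by auto
  ultimately show "(\<lambda>\<omega>. map \<omega> [0..<n]) -` {xs} \<inter> space (play_law G i \<pi> \<sigma>) \<in> sets (play_law G i \<pi> \<sigma>)"
    by (simp add: space_play_law)
qed auto

lemma distr_play_law_prefix:
  "distr (play_law G i \<pi> \<sigma>) (count_space UNIV) (\<lambda>\<omega>. map \<omega> [0..<n]) = measure_pmf (play_pmf G i \<pi> \<sigma> n)"
proof (rule measure_eqI_countable[of _ UNIV])
  fix xs :: "('a \<times> 'b \<times> 'c) list"
  have "emeasure (distr (play_law G i \<pi> \<sigma>) (count_space UNIV) (\<lambda>\<omega>. map \<omega> [0..<n])) {xs} =
      emeasure (play_law G i \<pi> \<sigma>) {\<omega>. map \<omega> [0..<n] = xs}"
    by (subst emeasure_distr[OF measurable_prefix]) (auto simp: space_play_law vimage_def)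
  also have "\<dots> = ennreal (pmf (play_pmf G i \<pi> \<sigma> n) xs)"
  proof (cases "length xs = n")
    case True
    then show ?thesis
      by (simp add: map_upt_eq_iff emeasure_play_law_cylinder pmf_play_pmf prod_ennreal)
  next
    case False
    then have "{\<omega>. map \<omega> [0..<n] = xs} = {}" "xs \<notin> set_pmf (play_pmf G i \<pi> \<sigma> n)"
      using length_play_pmf[of xs G i \<pi> \<sigma> n] by auto
    then show ?thesis
      by (simp add: set_pmf_iff)
  qed
  finally show "emeasure (distr (play_law G i \<pi> \<sigma>) (count_space UNIV) (\<lambda>\<omega>. map \<omega> [0..<n])) {xs} =
      emeasure (measure_pmf (play_pmf G i \<pi> \<sigma> n)) {xs}"
    by (simp add: emeasure_pmf_single)
qed auto

lemma integral_play_law_prefix: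
  fixes f :: "('s::finite \<times> 'a::finite \<times> 'b::finite) list \<Rightarrow> real"
  shows "(\<integral>\<omega>. f (map \<omega> [0..<n]) \<partial>play_law G i \<pi> \<sigma>) = measure_pmf.expectation (play_pmf G i \<pi> \<sigma> n) f"
  by (simp add: integral_distr[OF measurable_prefix] flip: distr_play_law_prefix)

lemma set_pmf_step_law_nth:
  assumes "length xs = n"
  shows "set_pmf (step_law G i \<pi> \<sigma> n ((!) xs)) =
    {(x, a, b). x \<in> set_pmf (state_law G i n ((!) xs)) \<and> a \<in> set_pmf (\<pi> n (xs, x)) \<and> b \<in> set_pmf (\<sigma> n (xs, x))}"
proof -
  have "map ((!) xs) [0..<n] = xs"
    using assms map_nth by auto
  then show ?thesis
    by (auto simp: step_law_def Let_def)
qed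

text \<open>
If the states in \<open>X\<close> admit only steps in \<open>K\<close>, and steps in \<open>K\<close> lead back to \<open>X\<close>, then the play
never leaves \<open>K\<close>. With all states and the admissible triples this gives admissibility of the
histories that occur; with a joint trap it contradicts irreducibility.
\<close>

lemma play_pmf_invariant:
  assumes start: "i \<in> X"
    and trans: "\<And>x a b. (x, a, b) \<in> K \<Longrightarrow> set_pmf (trans G x a b) \<subseteq> X"
    and act: "\<And>n xs x a b. length xs = n \<Longrightarrow> set xs \<subseteq> K \<Longrightarrow> x \<in> X \<Longrightarrow>
      a \<in> set_pmf (\<pi> n (xs, x)) \<Longrightarrow> b \<in> set_pmf (\<sigma> n (xs, x)) \<Longrightarrow> (x, a, b) \<in> K"
  shows "xs \<in> set_pmf (play_pmf G i \<pi> \<sigma> n) \<Longrightarrow> set xs \<subseteq> K"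
proof (induction n arbitrary: xs)
  case (Suc n)
  then obtain ys z where ys: "ys \<in> set_pmf (play_pmf G i \<pi> \<sigma> n)"
    and z: "z \<in> set_pmf (step_law G i \<pi> \<sigma> n ((!) ys))" and xs: "xs = ys @ [z]"
    by auto
  have len: "length ys = n"
    using ys by (rule length_play_pmf)
  have K: "set ys \<subseteq> K"
    using Suc.IH[OF ys] .
  have "set_pmf (state_law G i n ((!) ys)) \<subseteq> X"
  proof (cases n)
    case 0
    then show ?thesis
      using start by (simp add: state_law_def)
  next
    case (Suc m)
    then have "ys ! m \<in> K"
      using K len by auto
    then show ?thesis
      using Suc trans by (cases "ys ! m") (auto simp: state_law_def)
  qed
  then have "z \<in> K"
    using z act[OF len K] by (cases z) (auto simp: set_pmf_step_law_nth[OF len])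
  then show ?case
    using K by (simp add: xs)
qed simp

lemma set_pmf_policies1:
  "\<pi> \<in> policies1 G \<Longrightarrow> (xs, x) \<in> hists G n \<Longrightarrow> set_pmf (\<pi> n (xs, x)) \<subseteq> act1 G x"
  unfolding policies1_def mem_Collect_eq by (drule spec[of _ n], drule (1) bspec) simp

lemma set_pmf_policies2:
  "\<sigma> \<in> policies2 G \<Longrightarrow> (xs, x) \<in> hists G n \<Longrightarrow> set_pmf (\<sigma> n (xs, x)) \<subseteq> act2 G x"
  unfolding policies2_def mem_Collect_eq by (drule spec[of _ n], drule (1) bspec) simp

lemma play_pmf_adm:
  assumes "\<pi> \<in> policies1 G" "\<sigma> \<in> policies2 G" "xs \<in> set_pmf (play_pmf G i \<pi> \<sigma> n)"
  shows "(xs, x) \<in> hists G n"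
proof -
  have "set xs \<subseteq> adm G"
  proof (rule play_pmf_invariant[where X = UNIV, OF _ _ _ assms(3)])
    fix n xs x a b
    assume "length xs = n" "set xs \<subseteq> adm G" "a \<in> set_pmf (\<pi> n (xs, x))" "b \<in> set_pmf (\<sigma> n (xs, x))"
    then show "(x, a, b) \<in> adm G"
      using assms(1,2) by (fastforce simp: policies1_def policies2_def hists_def adm_def)
  qed auto
  then show ?thesis
    using length_play_pmf[OF assms(3)] by (simp add: hists_def)
qed

lemma irreducible_imp_no_joint_trap:
  fixes G :: "('s::finite, 'a::finite, 'b::finite) game"
  assumes game: "risk_game G"
    and irreducible: "\<And>f g. f \<in> sd_policies1 G \<Longrightarrow> g \<in> sd_policies2 G \<Longrightarrow> irreducible_under G f g"
  shows "no_joint_trap G"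
proof (rule ccontr)
  assume "\<not> no_joint_trap G"
  then have "\<exists>S. S \<noteq> {} \<and> S \<noteq> UNIV \<and>
      (\<forall>x\<in>S. \<exists>a\<in>act1 G x. \<exists>b\<in>act2 G x. set_pmf (trans G x a b) \<subseteq> S)"
    by (simp add: no_joint_trap_def)
  then obtain S where "S \<noteq> {}" "S \<noteq> UNIV"
    and trap: "\<forall>x\<in>S. \<exists>a\<in>act1 G x. \<exists>b\<in>act2 G x. set_pmf (trans G x a b) \<subseteq> S"
    by (elim exE conjE)
  have "\<exists>a b. a \<in> act1 G x \<and> b \<in> act2 G x \<and> (x \<in> S \<longrightarrow> set_pmf (trans G x a b) \<subseteq> S)" for x
  proof (cases "x \<in> S")
    case True
    then show ?thesis
      using trap by blast
  next
    case False
    then show ?thesis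
      using act1_ne[OF game, of x] act2_ne[OF game, of x] by blast
  qed
  then obtain f g where f: "\<And>x. f x \<in> act1 G x" and g: "\<And>x. g x \<in> act2 G x"
    and closed: "\<And>x. x \<in> S \<Longrightarrow> set_pmf (trans G x (f x) (g x)) \<subseteq> S"
    by metis
  define \<pi> :: "nat \<Rightarrow> ('s, 'a, 'b) hist \<Rightarrow> 'a pmf" where "\<pi> = (\<lambda>n h. return_pmf (f (snd h)))"
  define \<sigma> :: "nat \<Rightarrow> ('s, 'a, 'b) hist \<Rightarrow> 'b pmf" where "\<sigma> = (\<lambda>n h. return_pmf (g (snd h)))"
  have "\<pi> \<in> sd_policies1 G"
    using f by (auto simp: sd_policies1_def policies1_def \<pi>_def)
  moreover have "\<sigma> \<in> sd_policies2 G"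
    using g by (auto simp: sd_policies2_def policies2_def \<sigma>_def)
  ultimately have irr: "irreducible_under G \<pi> \<sigma>"
    by (rule irreducible)
  obtain i j where "i \<in> S" "j \<notin> S"
    using \<open>S \<noteq> {}\<close> \<open>S \<noteq> UNIV\<close> by blast
  then obtain n where n: "0 < measure (play_law G i \<pi> \<sigma>) {\<omega>. fst (\<omega> n) = j}"
    using irr by (auto simp: irreducible_under_def)
  let ?K = "{(x, a, b). x \<in> S \<and> a = f x \<and> b = g x}"
  have supp: "set xs \<subseteq> ?K" if "xs \<in> set_pmf (play_pmf G i \<pi> \<sigma> (Suc n))" for xs
    by (rule play_pmf_invariant[where X = S, OF \<open>i \<in> S\<close> _ _ that])
      (use closed in \<open>auto simp: \<pi>_def \<sigma>_def\<close>)
  have "measure (play_law G i \<pi> \<sigma>) {\<omega>. fst (\<omega> n) = j} =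
      measure (distr (play_law G i \<pi> \<sigma>) (count_space UNIV) (\<lambda>\<omega>. map \<omega> [0..<Suc n])) {xs. fst (xs ! n) = j}"
    by (subst measure_distr[OF measurable_prefix]) (auto simp: space_play_law vimage_def nth_append simp del: upt_Suc)
  also have "\<dots> = measure (measure_pmf (play_pmf G i \<pi> \<sigma> (Suc n))) {xs. fst (xs ! n) = j}"
    by (simp only: distr_play_law_prefix)
  also have "\<dots> = 0"
  proof (subst measure_pmf_zero_iff, rule ccontr)
    assume "set_pmf (play_pmf G i \<pi> \<sigma> (Suc n)) \<inter> {xs. fst (xs ! n) = j} \<noteq> {}"
    then obtain xs where xs: "xs \<in> set_pmf (play_pmf G i \<pi> \<sigma> (Suc n))" "fst (xs ! n) = j"
      by blast
    have "xs ! n \<in> set xs"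
      using length_play_pmf[OF xs(1)] by simp
    then have "xs ! n \<in> ?K"
      by (rule subsetD[OF supp[OF xs(1)]])
    then show False
      using xs(2) \<open>j \<notin> S\<close> by auto
  qed
  finally show False
    using n by simp
qed

section \<open>Growth of the exponential cost\<close>

definition path_cost :: "('s::finite, 'a::finite, 'b::finite) game \<Rightarrow> ('s \<times> 'a \<times> 'b) list \<Rightarrow> real" where
  "path_cost G xs = (\<Sum>(x, a, b)\<leftarrow>xs. cost G x a b)"

definition exp_cost ::
  "('s::finite, 'a::finite, 'b::finite) game \<Rightarrow> 's \<Rightarrow> (nat \<Rightarrow> ('s, 'a, 'b) hist \<Rightarrow> 'a pmf) \<Rightarrow>
   (nat \<Rightarrow> ('s, 'a, 'b) hist \<Rightarrow> 'b pmf) \<Rightarrow> nat \<Rightarrow> real" where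
  "exp_cost G i \<pi> \<sigma> n = measure_pmf.expectation (play_pmf G i \<pi> \<sigma> n) (\<lambda>xs. exp (risk G * path_cost G xs))"

lemma criterion_eq:
  "criterion G i \<pi> \<sigma> = limsup (\<lambda>n. ereal (1 / (risk G * real n) * ln (exp_cost G i \<pi> \<sigma> n)))"
proof -
  have "(\<Sum>k<n. case \<omega> k of (x, a, b) \<Rightarrow> cost G x a b) = path_cost G (map \<omega> [0..<n])" for \<omega> n
    by (induction n) (auto simp: path_cost_def)
  then show ?thesis
    by (simp add: criterion_def exp_cost_def
        integral_play_law_prefix[where f = "\<lambda>xs. exp (risk G * path_cost G xs)"])
qed

text \<open>
The sum is the conditional expectation of \<open>h\<close> at the state that follows the history. Using it
instead of \<open>h\<close> at that state keeps the weight a function of the first \<open>n\<close> coordinates.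
\<close>

definition weight ::
  "('s::finite, 'a::finite, 'b::finite) game \<Rightarrow> 's \<Rightarrow> ('s \<Rightarrow> real) \<Rightarrow> nat \<Rightarrow> ('s \<times> 'a \<times> 'b) list \<Rightarrow> real" where
  "weight G i h n xs = exp (risk G * path_cost G xs) * (\<Sum>x\<in>UNIV. h x * pmf (state_law G i n ((!) xs)) x)"

lemma weight_snoc:
  "length xs = n \<Longrightarrow>
    weight G i h (Suc n) (xs @ [(x, a, b)]) = exp (risk G * path_cost G xs) * one_step G h x a b"
  by (simp add: weight_def path_cost_def one_step_def state_law_def nth_append exp_add ring_distribs mult.assoc)

lemma mixed_payoff_UNIV:
  fixes A :: "'a::finite set" and B :: "'b::finite set"
  assumes "set_pmf \<mu> \<subseteq> A" "set_pmf \<nu> \<subseteq> B"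
  shows "mixed_payoff UNIV UNIV Q \<mu> \<nu> = mixed_payoff A B Q \<mu> \<nu>"
proof -
  have "mixed_payoff A B Q \<mu> \<nu> = (\<Sum>a\<in>A. \<Sum>b\<in>UNIV. Q a b * pmf \<mu> a * pmf \<nu> b)"
    unfolding mixed_payoff_def using assms
    by (intro sum.cong sum.mono_neutral_left) (auto simp: set_pmf_iff)
  also have "\<dots> = mixed_payoff UNIV UNIV Q \<mu> \<nu>"
    unfolding mixed_payoff_def using assms
  proof (intro sum.mono_neutral_left ballI)
    fix a assume "a \<in> UNIV - A"
    then have "pmf \<mu> a = 0"
      using assms(1) by (auto simp: set_pmf_iff)
    then show "(\<Sum>b\<in>UNIV. Q a b * pmf \<mu> a * pmf \<nu> b) = 0"
      by simp
  qed auto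
  finally show ?thesis ..
qed

text \<open>
The conditional expectation of the next weight is an average of mixed payoffs in the matrix games
of the operator. Together with a super- or subsolution \<open>h\<close>, it makes the weight, rescaled by
powers of \<open>\<kappa>\<close>, a super- or submartingale.
\<close>

lemma expectation_weight_Suc:
  fixes G :: "('s::finite, 'a::finite, 'b::finite) game"
  assumes "length xs = n"
  shows "measure_pmf.expectation (step_law G i \<pi> \<sigma> n ((!) xs)) (\<lambda>z. weight G i h (Suc n) (xs @ [z])) =
    exp (risk G * path_cost G xs) * (\<Sum>x\<in>UNIV. mixed_payoff UNIV UNIV (one_step G h x) (\<pi> n (xs, x)) (\<sigma> n (xs, x)) *
      pmf (state_law G i n ((!) xs)) x)"
proof -
  have nth: "map ((!) xs) [0..<n] = xs"
    using assms map_nth by auto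
  have "measure_pmf.expectation (step_law G i \<pi> \<sigma> n ((!) xs)) (\<lambda>z. weight G i h (Suc n) (xs @ [z])) =
      (\<Sum>z\<in>UNIV. weight G i h (Suc n) (xs @ [z]) * pmf (step_law G i \<pi> \<sigma> n ((!) xs)) z)"
    by (rule integral_measure_pmf_real) auto
  also have "\<dots> = (\<Sum>x\<in>UNIV. \<Sum>a\<in>UNIV. \<Sum>b\<in>UNIV.
      weight G i h (Suc n) (xs @ [(x, a, b)]) * pmf (step_law G i \<pi> \<sigma> n ((!) xs)) (x, a, b))"
    by (simp only: sum.cartesian_product UNIV_Times_UNIV) (simp add: case_prod_unfold)
  also have "\<dots> = exp (risk G * path_cost G xs) * (\<Sum>x\<in>UNIV.
      mixed_payoff UNIV UNIV (one_step G h x) (\<pi> n (xs, x)) (\<sigma> n (xs, x)) * pmf (state_law G i n ((!) xs)) x)"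
    by (simp add: weight_snoc[OF assms] pmf_step_law nth mixed_payoff_def sum_distrib_left sum_distrib_right mult_ac)
  finally show ?thesis .
qed

lemma expectation_weight_0: "measure_pmf.expectation (play_pmf G i \<pi> \<sigma> 0) (weight G i h 0) = h i"
  by (simp add: weight_def path_cost_def state_law_def sum.remove[of UNIV i] pmf_return)

lemma expectation_play_pmf_Suc:
  fixes f :: "_ \<Rightarrow> real"
  shows "measure_pmf.expectation (play_pmf G i \<pi> \<sigma> (Suc n)) f =
   measure_pmf.expectation (play_pmf G i \<pi> \<sigma> n)
     (\<lambda>xs. measure_pmf.expectation (step_law G i \<pi> \<sigma> n ((!) xs)) (\<lambda>z. f (xs @ [z])))"
  unfolding play_pmf.simps
  by (subst pmf_expectation_bind[of "set_pmf (play_pmf G i \<pi> \<sigma> n)"])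
    (auto simp: finite_set_play_pmf integral_measure_pmf_real[OF finite_set_play_pmf] mult.commute)

lemma expectation_play_pmf_mono:
  fixes f f' :: "_ \<Rightarrow> real"
  assumes "\<And>xs. xs \<in> set_pmf (play_pmf G i \<pi> \<sigma> n) \<Longrightarrow> f xs \<le> f' xs"
  shows "measure_pmf.expectation (play_pmf G i \<pi> \<sigma> n) f \<le> measure_pmf.expectation (play_pmf G i \<pi> \<sigma> n) f'"
  using assms
  by (intro integral_mono_AE) (auto simp: AE_measure_pmf_iff finite_set_play_pmf intro!: integrable_measure_pmf_finite)

lemma rate_tendsto:
  fixes C \<kappa> \<theta> :: real
  assumes "0 < C" "0 < \<kappa>" "0 < \<theta>"
  shows "(\<lambda>n. 1 / (\<theta> * real n) * ln (C * \<kappa> ^ n)) \<longlonglongrightarrow> ln \<kappa> / \<theta>"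
proof -
  have "(\<lambda>n. ln C / \<theta> * (1 / real n) + ln \<kappa> / \<theta>) \<longlonglongrightarrow> ln C / \<theta> * 0 + ln \<kappa> / \<theta>"
    by (intro tendsto_intros lim_1_over_n)
  moreover have "\<forall>\<^sub>F n in sequentially. ln C / \<theta> * (1 / real n) + ln \<kappa> / \<theta> = 1 / (\<theta> * real n) * ln (C * \<kappa> ^ n)"
    using eventually_gt_at_top[of 0]
    by eventually_elim (use assms in \<open>simp add: ln_mult ln_realpow field_simps\<close>)
  ultimately show ?thesis
    by (simp add: tendsto_cong)
qed

context
  fixes G :: "('s::finite, 'a::finite, 'b::finite) game" and \<pi> \<sigma>
  assumes game: "risk_game G" and \<pi>: "\<pi> \<in> policies1 G" and \<sigma>: "\<sigma> \<in> policies2 G"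
begin

abbreviation step_payoff :: "('s \<Rightarrow> real) \<Rightarrow> nat \<Rightarrow> ('s \<times> 'a \<times> 'b) list \<Rightarrow> 's \<Rightarrow> real" where
  "step_payoff h n xs x \<equiv>
     mixed_payoff (act1 G x) (act2 G x) (one_step G h x) (\<pi> n (xs, x)) (\<sigma> n (xs, x))"

lemma step_payoff_UNIV:
  "(xs, x) \<in> hists G n \<Longrightarrow>
    mixed_payoff UNIV UNIV (one_step G h x) (\<pi> n (xs, x)) (\<sigma> n (xs, x)) = step_payoff h n xs x"
  by (intro mixed_payoff_UNIV set_pmf_policies1[OF \<pi>] set_pmf_policies2[OF \<sigma>])

lemma expectation_weight_le:
  assumes "0 < \<kappa>" and le: "\<And>n xs x. (xs, x) \<in> hists G n \<Longrightarrow> step_payoff h n xs x \<le> \<kappa> * h x"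
  shows "measure_pmf.expectation (play_pmf G i \<pi> \<sigma> n) (weight G i h n) \<le> \<kappa> ^ n * h i"
proof (induction n)
  case 0
  show ?case
    by (simp only: expectation_weight_0) simp
next
  case (Suc n)
  have "measure_pmf.expectation (play_pmf G i \<pi> \<sigma> (Suc n)) (weight G i h (Suc n)) \<le>
      measure_pmf.expectation (play_pmf G i \<pi> \<sigma> n) (\<lambda>xs. \<kappa> * weight G i h n xs)"
    unfolding expectation_play_pmf_Suc
  proof (rule expectation_play_pmf_mono)
    fix xs assume xs: "xs \<in> set_pmf (play_pmf G i \<pi> \<sigma> n)"
    note hist = play_pmf_adm[OF \<pi> \<sigma> xs]
    have "measure_pmf.expectation (step_law G i \<pi> \<sigma> n ((!) xs)) (\<lambda>z. weight G i h (Suc n) (xs @ [z])) =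
        exp (risk G * path_cost G xs) * (\<Sum>x\<in>UNIV. step_payoff h n xs x * pmf (state_law G i n ((!) xs)) x)"
      by (simp add: expectation_weight_Suc[OF length_play_pmf[OF xs]] step_payoff_UNIV[OF hist])
    also have "\<dots> \<le> exp (risk G * path_cost G xs) * (\<Sum>x\<in>UNIV. \<kappa> * h x * pmf (state_law G i n ((!) xs)) x)"
      using le[OF hist] by (intro mult_left_mono sum_mono mult_right_mono) auto
    also have "\<dots> = \<kappa> * weight G i h n xs"
      by (simp add: weight_def sum_distrib_left mult_ac)
    finally show "measure_pmf.expectation (step_law G i \<pi> \<sigma> n ((!) xs)) (\<lambda>z. weight G i h (Suc n) (xs @ [z]))
        \<le> \<kappa> * weight G i h n xs" .
  qed
  also have "\<dots> = \<kappa> * measure_pmf.expectation (play_pmf G i \<pi> \<sigma> n) (weight G i h n)"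
    by simp
  also have "\<dots> \<le> \<kappa> * (\<kappa> ^ n * h i)"
    using \<open>0 < \<kappa>\<close> by (intro mult_left_mono Suc.IH) auto
  finally show ?case
    by simp
qed

lemma expectation_weight_ge:
  assumes "0 < \<kappa>" and ge: "\<And>n xs x. (xs, x) \<in> hists G n \<Longrightarrow> \<kappa> * h x \<le> step_payoff h n xs x"
  shows "\<kappa> ^ n * h i \<le> measure_pmf.expectation (play_pmf G i \<pi> \<sigma> n) (weight G i h n)"
proof (induction n)
  case 0
  show ?case
    by (simp only: expectation_weight_0) simp
next
  case (Suc n)
  have "\<kappa> ^ Suc n * h i = \<kappa> * (\<kappa> ^ n * h i)"
    by simp
  also have "\<dots> \<le> \<kappa> * measure_pmf.expectation (play_pmf G i \<pi> \<sigma> n) (weight G i h n)"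
    using \<open>0 < \<kappa>\<close> by (intro mult_left_mono Suc.IH) auto
  also have "\<dots> = measure_pmf.expectation (play_pmf G i \<pi> \<sigma> n) (\<lambda>xs. \<kappa> * weight G i h n xs)"
    by simp
  also have "\<dots> \<le> measure_pmf.expectation (play_pmf G i \<pi> \<sigma> (Suc n)) (weight G i h (Suc n))"
    unfolding expectation_play_pmf_Suc
  proof (rule expectation_play_pmf_mono)
    fix xs assume xs: "xs \<in> set_pmf (play_pmf G i \<pi> \<sigma> n)"
    note hist = play_pmf_adm[OF \<pi> \<sigma> xs]
    have "\<kappa> * weight G i h n xs =
        exp (risk G * path_cost G xs) * (\<Sum>x\<in>UNIV. \<kappa> * h x * pmf (state_law G i n ((!) xs)) x)"
      by (simp add: weight_def sum_distrib_left mult_ac)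
    also have "\<dots> \<le> exp (risk G * path_cost G xs) *
        (\<Sum>x\<in>UNIV. step_payoff h n xs x * pmf (state_law G i n ((!) xs)) x)"
      using ge[OF hist] by (intro mult_left_mono sum_mono mult_right_mono) auto
    also have "\<dots> = measure_pmf.expectation (step_law G i \<pi> \<sigma> n ((!) xs)) (\<lambda>z. weight G i h (Suc n) (xs @ [z]))"
      by (simp add: expectation_weight_Suc[OF length_play_pmf[OF xs]] step_payoff_UNIV[OF hist])
    finally show "\<kappa> * weight G i h n xs \<le>
        measure_pmf.expectation (step_law G i \<pi> \<sigma> n ((!) xs)) (\<lambda>z. weight G i h (Suc n) (xs @ [z]))" .
  qed
  finally show ?case .
qed

lemma exp_cost_ge_1: "1 \<le> exp_cost G i \<pi> \<sigma> n"
proof -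
  have "1 = measure_pmf.expectation (play_pmf G i \<pi> \<sigma> n) (\<lambda>_. 1 :: real)"
    by simp
  also have "\<dots> \<le> exp_cost G i \<pi> \<sigma> n"
    unfolding exp_cost_def
  proof (rule expectation_play_pmf_mono)
    fix xs assume "xs \<in> set_pmf (play_pmf G i \<pi> \<sigma> n)"
    then have "set xs \<subseteq> adm G"
      using play_pmf_adm[OF \<pi> \<sigma>] by (auto simp: hists_def)
    then have "0 \<le> path_cost G xs"
      unfolding path_cost_def using cost_nonneg[OF game] by (intro sum_list_nonneg) (auto simp: adm_def)
    then show "1 \<le> exp (risk G * path_cost G xs)"
      using risk_pos[OF game] by simp
  qed
  finally show ?thesis .
qed

lemma exp_cost_le_weight:
  assumes "\<And>x. r \<le> h x"
  shows "r * exp_cost G i \<pi> \<sigma> n \<le> measure_pmf.expectation (play_pmf G i \<pi> \<sigma> n) (weight G i h n)"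
proof -
  have "r * exp_cost G i \<pi> \<sigma> n =
      measure_pmf.expectation (play_pmf G i \<pi> \<sigma> n) (\<lambda>xs. r * exp (risk G * path_cost G xs))"
    by (simp add: exp_cost_def)
  also have "\<dots> \<le> measure_pmf.expectation (play_pmf G i \<pi> \<sigma> n) (weight G i h n)"
  proof (rule expectation_play_pmf_mono)
    fix xs
    let ?p = "state_law G i n ((!) xs)"
    have "r = (\<Sum>x\<in>UNIV. r * pmf ?p x)"
      by (simp add: sum_pmf_eq_1 flip: sum_distrib_left)
    also have "\<dots> \<le> (\<Sum>x\<in>UNIV. h x * pmf ?p x)"
      using assms by (intro sum_mono mult_right_mono) auto
    finally have "exp (risk G * path_cost G xs) * r \<le> weight G i h n xs"
      unfolding weight_def by (intro mult_left_mono) auto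
    then show "r * exp (risk G * path_cost G xs) \<le> weight G i h n xs"
      by (simp add: mult.commute)
  qed
  finally show ?thesis .
qed

lemma exp_cost_ge_weight:
  assumes "\<And>x. h x \<le> r"
  shows "measure_pmf.expectation (play_pmf G i \<pi> \<sigma> n) (weight G i h n) \<le> r * exp_cost G i \<pi> \<sigma> n"
proof -
  have "measure_pmf.expectation (play_pmf G i \<pi> \<sigma> n) (weight G i h n) \<le>
      measure_pmf.expectation (play_pmf G i \<pi> \<sigma> n) (\<lambda>xs. r * exp (risk G * path_cost G xs))"
  proof (rule expectation_play_pmf_mono)
    fix xs
    let ?p = "state_law G i n ((!) xs)"
    have "(\<Sum>x\<in>UNIV. h x * pmf ?p x) \<le> (\<Sum>x\<in>UNIV. r * pmf ?p x)"
      using assms by (intro sum_mono mult_right_mono) auto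
    also have "\<dots> = r"
      by (simp add: sum_pmf_eq_1 flip: sum_distrib_left)
    finally have "weight G i h n xs \<le> exp (risk G * path_cost G xs) * r"
      unfolding weight_def by (intro mult_left_mono) auto
    then show "weight G i h n xs \<le> r * exp (risk G * path_cost G xs)"
      by (simp add: mult.commute)
  qed
  also have "\<dots> = r * exp_cost G i \<pi> \<sigma> n"
    by (simp add: exp_cost_def)
  finally show ?thesis .
qed

text \<open>
Since \<open>h\<close> is positive on a finite set, it lies between two positive constants, and the exponential cost and the expected
weight agree up to constant factors, which the growth rate does not see.
\<close>

lemma criterion_le:
  assumes "0 < \<kappa>" and h: "\<And>x. 0 < h x"
    and le: "\<And>n xs x. (xs, x) \<in> hists G n \<Longrightarrow> step_payoff h n xs x \<le> \<kappa> * h x"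
  shows "criterion G i \<pi> \<sigma> \<le> ereal (ln \<kappa> / risk G)"
proof -
  define r where "r = Min (range h)"
  have "0 < r" and r: "\<And>x. r \<le> h x"
    using h by (auto simp: r_def)
  have "exp_cost G i \<pi> \<sigma> n \<le> h i / r * \<kappa> ^ n" for n
  proof -
    have "r * exp_cost G i \<pi> \<sigma> n \<le> \<kappa> ^ n * h i"
      using exp_cost_le_weight[OF r] expectation_weight_le[OF \<open>0 < \<kappa>\<close> le] by (rule order_trans)
    then show ?thesis
      using \<open>0 < r\<close> by (simp add: field_simps)
  qed
  then have "1 / (risk G * real n) * ln (exp_cost G i \<pi> \<sigma> n) \<le> 1 / (risk G * real n) * ln (h i / r * \<kappa> ^ n)" for n
    using exp_cost_ge_1[of i n] risk_pos[OF game] h[of i] \<open>0 < r\<close> \<open>0 < \<kappa>\<close>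
    by (intro mult_left_mono ln_mono) (auto intro: order_less_le_trans[OF zero_less_one])
  then have "criterion G i \<pi> \<sigma> \<le> limsup (\<lambda>n. ereal (1 / (risk G * real n) * ln (h i / r * \<kappa> ^ n)))"
    unfolding criterion_eq by (intro Limsup_mono always_eventually) simp
  also have "\<dots> = ereal (ln \<kappa> / risk G)"
    using rate_tendsto[of "h i / r" \<kappa> "risk G"] h[of i] \<open>0 < r\<close> \<open>0 < \<kappa>\<close> risk_pos[OF game]
    by (intro lim_imp_Limsup) auto
  finally show ?thesis .
qed

lemma criterion_ge:
  assumes "0 < \<kappa>" and h: "\<And>x. 0 < h x"
    and ge: "\<And>n xs x. (xs, x) \<in> hists G n \<Longrightarrow> \<kappa> * h x \<le> step_payoff h n xs x"
  shows "ereal (ln \<kappa> / risk G) \<le> criterion G i \<pi> \<sigma>"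
proof -
  define r where "r = Max (range h)"
  have r: "\<And>x. h x \<le> r"
    by (auto simp: r_def)
  then have "0 < r"
    using h[of i] by (rule order_less_le_trans[rotated])
  have "h i / r * \<kappa> ^ n \<le> exp_cost G i \<pi> \<sigma> n" for n
  proof -
    have "\<kappa> ^ n * h i \<le> r * exp_cost G i \<pi> \<sigma> n"
      using expectation_weight_ge[OF \<open>0 < \<kappa>\<close> ge] exp_cost_ge_weight[OF r] by (rule order_trans)
    then show ?thesis
      using \<open>0 < r\<close> by (simp add: field_simps)
  qed
  then have "1 / (risk G * real n) * ln (h i / r * \<kappa> ^ n) \<le> 1 / (risk G * real n) * ln (exp_cost G i \<pi> \<sigma> n)" for n
    using risk_pos[OF game] h[of i] \<open>0 < r\<close> \<open>0 < \<kappa>\<close>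
    by (intro mult_left_mono ln_mono) auto
  then have "limsup (\<lambda>n. ereal (1 / (risk G * real n) * ln (h i / r * \<kappa> ^ n))) \<le> criterion G i \<pi> \<sigma>"
    unfolding criterion_eq by (intro Limsup_mono always_eventually) simp
  moreover have "limsup (\<lambda>n. ereal (1 / (risk G * real n) * ln (h i / r * \<kappa> ^ n))) = ereal (ln \<kappa> / risk G)"
    using rate_tendsto[of "h i / r" \<kappa> "risk G"] h[of i] \<open>0 < r\<close> \<open>0 < \<kappa>\<close> risk_pos[OF game]
    by (intro lim_imp_Limsup) auto
  ultimately show ?thesis
    by simp
qed

end

section \<open>The growth rate is the value\<close>

lemma lower_value_le_upper_value: "lower_value G i \<le> upper_value G i"
  unfolding lower_value_def upper_value_def
  by (intro SUP_least INF_greatest) (meson INF_lower SUP_upper order_trans)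

context
  fixes G :: "('s::finite, 'a::finite, 'b::finite) game"
  assumes game: "risk_game G"
begin

lemma zet_ge_1: "1 \<le> zet G n"
  using Min_iter_one_ge_1[OF game, of "2 ^ n"] by (simp add: zet_def)

lemma zet_le_lam: "zet G n \<le> lam G n"
  using Min_le_Max_iter_one[OF game, of "2 ^ n"] by (simp add: zet_def lam_def)

lemma zet_pos: "0 < zet G n" and lam_pos: "0 < lam G n"
  using zet_ge_1[of n] zet_le_lam[of n] by linarith+

lemma lam_power: "lam G n ^ 2 ^ n = (MAX x. iter_one G (2 ^ n) x)"
proof -
  have "0 \<le> (MAX x. iter_one G (2 ^ n) x)"
    using Min_iter_one_ge_1[OF game, of "2 ^ n"] Min_le_Max_iter_one[OF game, of "2 ^ n"] by linarith
  then show ?thesis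
    by (simp add: lam_def)
qed

lemma zet_power: "zet G n ^ 2 ^ n = (MIN x. iter_one G (2 ^ n) x)"
proof -
  have "0 \<le> (MIN x. iter_one G (2 ^ n) x)"
    using Min_iter_one_ge_1[OF game, of "2 ^ n"] by linarith
  then show ?thesis
    by (simp add: zet_def)
qed

lemma lam_Suc_le: "lam G (Suc n) \<le> lam G n"
proof (rule power_le_imp_le_base)
  have "lam G (Suc n) ^ 2 ^ Suc n \<le> (lam G n ^ 2 ^ n) ^ 2"
    using Max_iter_one_double[OF game, of "2 ^ n"] lam_power[of "Suc n"] lam_power[of n] by simp
  also have "\<dots> = lam G n ^ 2 ^ Suc n"
    by (simp add: mult.commute flip: power_mult)
  finally show "lam G (Suc n) ^ Suc (2 ^ Suc n - 1) \<le> lam G n ^ Suc (2 ^ Suc n - 1)"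
    by simp
qed (use lam_pos[of n] in simp)

lemma zet_Suc_ge: "zet G n \<le> zet G (Suc n)"
proof (rule power_le_imp_le_base)
  have "zet G n ^ 2 ^ Suc n = (zet G n ^ 2 ^ n) ^ 2"
    by (simp add: mult.commute flip: power_mult)
  also have "\<dots> \<le> zet G (Suc n) ^ 2 ^ Suc n"
    using Min_iter_one_double[OF game, of "2 ^ n"] zet_power[of "Suc n"] zet_power[of n] by simp
  finally show "zet G n ^ Suc (2 ^ Suc n - 1) \<le> zet G (Suc n) ^ Suc (2 ^ Suc n - 1)"
    by simp
qed (use zet_pos[of "Suc n"] in simp)

lemma decseq_log_lam: "decseq (\<lambda>n. ln (lam G n) / risk G)"
  using lam_Suc_le lam_pos risk_pos[OF game] by (intro decseq_SucI divide_right_mono ln_mono) auto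

lemma incseq_log_zet: "incseq (\<lambda>n. ln (zet G n) / risk G)"
  using zet_Suc_ge zet_pos risk_pos[OF game] by (intro incseq_SucI divide_right_mono ln_mono) auto

text \<open>
The ratio of maximum and minimum is bounded by a constant \<open>C\<close>, so its \<open>2^n\<close>-th root
tends to one.
\<close>

lemma log_lam_minus_log_zet_tendsto_0:
  assumes "no_joint_trap G"
  shows "(\<lambda>n. ln (lam G n) / risk G - ln (zet G n) / risk G) \<longlonglongrightarrow> 0"
proof -
  obtain C where "0 < C" and C: "\<And>n. (MAX x. iter_one G n x) \<le> C * (MIN x. iter_one G n x)"
    using Max_Min_iter_one_comparable[OF game assms] by blast
  have upper: "ln (lam G n) / risk G - ln (zet G n) / risk G \<le> ln C / risk G * (1 / 2) ^ n" for n
  proof -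
    have "lam G n ^ 2 ^ n \<le> C * zet G n ^ 2 ^ n"
      unfolding lam_power zet_power by (rule C)
    then have "ln (lam G n ^ 2 ^ n) \<le> ln (C * zet G n ^ 2 ^ n)"
      using lam_pos[of n] zet_pos[of n] \<open>0 < C\<close> by (intro ln_mono) auto
    then have "2 ^ n * ln (lam G n) \<le> ln C + 2 ^ n * ln (zet G n)"
      using lam_pos[of n] zet_pos[of n] \<open>0 < C\<close> by (simp add: ln_mult ln_realpow)
    then have "ln (lam G n) - ln (zet G n) \<le> ln C * (1 / 2) ^ n"
      by (simp add: field_simps)
    then have "(ln (lam G n) - ln (zet G n)) / risk G \<le> ln C * (1 / 2) ^ n / risk G"
      using risk_pos[OF game] by (intro divide_right_mono) auto
    then show ?thesis
      by (simp add: diff_divide_distrib)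
  qed
  have lower: "0 \<le> ln (lam G n) / risk G - ln (zet G n) / risk G" for n
    using zet_le_lam[of n] zet_pos[of n] risk_pos[OF game] by (simp add: divide_right_mono)
  have "(\<lambda>n. ln C / risk G * (1 / 2) ^ n) \<longlonglongrightarrow> 0"
    by (intro tendsto_mult_right_zero LIMSEQ_power_zero) simp
  then show ?thesis
    by (rule tendsto_sandwich[OF always_eventually always_eventually tendsto_const, OF allI allI, OF lower upper])
qed

text \<open>
Slightly above the growth rate \<open>lam G n\<close>, the superharmonic function provides in every state
a mixed action of player 1 that is good against all mixed actions of player 2. Playing it
stationarily bounds the criterion against every history-dependent opponent.
\<close>

lemma upper_value_le: "upper_value G i \<le> ereal (ln (lam G n) / risk G)"
proof (rule dense_ge)
  fix z :: ereal
  assume z: "ereal (ln (lam G n) / risk G) < z"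
  show "upper_value G i \<le> z"
  proof (cases z)
    case (real v)
    define \<kappa> where "\<kappa> = exp (risk G * v)"
    have "ln (lam G n) < risk G * v"
      using z real risk_pos[OF game] by (simp add: field_simps)
    then have \<kappa>: "lam G n < \<kappa>"
      using lam_pos[of n] by (metis \<kappa>_def exp_less_cancel_iff exp_ln)
    have "iter_one G (2 ^ n) x \<le> lam G n ^ 2 ^ n" for x
      unfolding lam_power by simp
    then obtain h where h: "\<And>x. 0 < h x" "\<And>x. L_op G h x \<le> lam G n * h x"
      using superharmonic_exists[OF game _ lam_pos] by (metis zero_less_numeral zero_less_power)
    have "\<exists>\<mu>. set_pmf \<mu> \<subseteq> act1 G x \<and> (\<forall>\<nu>. set_pmf \<nu> \<subseteq> act2 G x \<longrightarrow>
        mixed_payoff (act1 G x) (act2 G x) (one_step G h x) \<mu> \<nu> \<le> \<kappa> * h x)" for x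
    proof -
      have "lam G n * h x < \<kappa> * h x"
        using \<kappa> h(1) by simp
      then have "matrix_value (act1 G x) (act2 G x) (one_step G h x) < \<kappa> * h x"
        using h(2)[of x] by (simp add: L_op_eq_matrix_value)
      from matrix_value_less_obtains[OF act1_ne[OF game] act2_ne[OF game] this] show ?thesis
        by metis
    qed
    then obtain \<mu> where \<mu>: "\<And>x. set_pmf (\<mu> x) \<subseteq> act1 G x"
      and le: "\<And>x \<nu>. set_pmf \<nu> \<subseteq> act2 G x \<Longrightarrow>
        mixed_payoff (act1 G x) (act2 G x) (one_step G h x) (\<mu> x) \<nu> \<le> \<kappa> * h x"
      by metis
    define \<pi> :: "nat \<Rightarrow> ('s, 'a, 'b) hist \<Rightarrow> 'a pmf" where "\<pi> = (\<lambda>n hs. \<mu> (snd hs))"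
    have \<pi>: "\<pi> \<in> policies1 G"
      using \<mu> by (auto simp: policies1_def \<pi>_def)
    have "criterion G i \<pi> \<sigma> \<le> ereal v" if \<sigma>: "\<sigma> \<in> policies2 G" for \<sigma>
    proof -
      have "criterion G i \<pi> \<sigma> \<le> ereal (ln \<kappa> / risk G)"
      proof (rule criterion_le[OF game \<pi> \<sigma> _ h(1)])
        fix n xs x assume hist: "(xs, x) \<in> hists G n"
        have "set_pmf (\<sigma> n (xs, x)) \<subseteq> act2 G x"
          using \<sigma> hist by (rule set_pmf_policies2)
        then show "mixed_payoff (act1 G x) (act2 G x) (one_step G h x) (\<pi> n (xs, x)) (\<sigma> n (xs, x)) \<le> \<kappa> * h x"
          by (simp add: \<pi>_def le)
      qed (simp add: \<kappa>_def)
      then show ?thesis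
        using risk_pos[OF game] by (simp add: \<kappa>_def)
    qed
    then show ?thesis
      unfolding upper_value_def real by (intro INF_lower2[OF \<pi>] SUP_least)
  qed (use z in auto)
qed

text \<open>
The dual of the previous argument. Player 2 must commit to a strategy before player 1 answers, so
here the minimax theorem supplies the mixed action.
\<close>

lemma lower_value_ge: "ereal (ln (zet G n) / risk G) \<le> lower_value G i"
proof (rule dense_le)
  fix z :: ereal
  assume z: "z < ereal (ln (zet G n) / risk G)"
  show "z \<le> lower_value G i"
  proof (cases z)
    case (real v)
    define \<kappa> where "\<kappa> = exp (risk G * v)"
    have "risk G * v < ln (zet G n)"
      using z real risk_pos[OF game] by (simp add: field_simps)
    then have \<kappa>: "\<kappa> < zet G n"
      using zet_pos[of n] by (metis \<kappa>_def exp_less_cancel_iff exp_ln)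
    have "zet G n ^ 2 ^ n \<le> iter_one G (2 ^ n) x" for x
      unfolding zet_power by simp
    then obtain h where h: "\<And>x. 0 < h x" "\<And>x. zet G n * h x \<le> L_op G h x"
      using subharmonic_exists[OF game _ zet_pos] by (metis zero_less_numeral zero_less_power)
    have "\<exists>\<nu>. set_pmf \<nu> \<subseteq> act2 G x \<and> (\<forall>\<mu>. set_pmf \<mu> \<subseteq> act1 G x \<longrightarrow>
        \<kappa> * h x \<le> mixed_payoff (act1 G x) (act2 G x) (one_step G h x) \<mu> \<nu>)" for x
    proof -
      have "\<kappa> * h x < zet G n * h x"
        using \<kappa> h(1) by simp
      then have "\<kappa> * h x < matrix_value (act1 G x) (act2 G x) (one_step G h x)"
        using h(2)[of x] by (simp add: L_op_eq_matrix_value)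
      from matrix_minimax[OF act1_ne[OF game] act2_ne[OF game] this] show ?thesis
        by metis
    qed
    then obtain \<nu> where \<nu>: "\<And>x. set_pmf (\<nu> x) \<subseteq> act2 G x"
      and ge: "\<And>x \<mu>. set_pmf \<mu> \<subseteq> act1 G x \<Longrightarrow>
        \<kappa> * h x \<le> mixed_payoff (act1 G x) (act2 G x) (one_step G h x) \<mu> (\<nu> x)"
      by metis
    define \<sigma> :: "nat \<Rightarrow> ('s, 'a, 'b) hist \<Rightarrow> 'b pmf" where "\<sigma> = (\<lambda>n hs. \<nu> (snd hs))"
    have \<sigma>: "\<sigma> \<in> policies2 G"
      using \<nu> by (auto simp: policies2_def \<sigma>_def)
    have "ereal v \<le> criterion G i \<pi> \<sigma>" if \<pi>: "\<pi> \<in> policies1 G" for \<pi>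
    proof -
      have "ereal (ln \<kappa> / risk G) \<le> criterion G i \<pi> \<sigma>"
      proof (rule criterion_ge[OF game \<pi> \<sigma> _ h(1)])
        fix n xs x assume hist: "(xs, x) \<in> hists G n"
        have "set_pmf (\<pi> n (xs, x)) \<subseteq> act1 G x"
          using \<pi> hist by (rule set_pmf_policies1)
        then show "\<kappa> * h x \<le> mixed_payoff (act1 G x) (act2 G x) (one_step G h x) (\<pi> n (xs, x)) (\<sigma> n (xs, x))"
          by (simp add: \<sigma>_def ge)
      qed (simp add: \<kappa>_def)
      then show ?thesis
        using risk_pos[OF game] by (simp add: \<kappa>_def)
    qed
    then show ?thesis
      unfolding lower_value_def real by (intro SUP_upper2[OF \<sigma>] INF_greatest)
  qed (use z in auto)
qed

end

theorem theorem3p1: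
  fixes G :: "('s::finite, 'a::finite, 'b::finite) game"
  assumes game: "risk_game G"
    and irreducible: "\<And>f g. f \<in> sd_policies1 G \<Longrightarrow> g \<in> sd_policies2 G \<Longrightarrow> irreducible_under G f g"
  shows "\<exists>\<rho>::real.
    value_exists G \<and> (\<forall>i. game_value G i = ereal \<rho>) \<and>
    (decseq (\<lambda>n. ln (lam G n) / risk G) \<and> (\<lambda>n. ln (lam G n) / risk G) \<longlonglongrightarrow> \<rho>) \<and>
    (incseq (\<lambda>n. ln (zet G n) / risk G) \<and> (\<lambda>n. ln (zet G n) / risk G) \<longlonglongrightarrow> \<rho>) \<and>
    (\<forall>\<epsilon>>0.
      (\<exists>n\<ge>1. lam G n / zet G n \<le> exp (risk G * \<epsilon>)) \<and>
      (\<forall>n\<ge>1. lam G n / zet G n \<le> exp (risk G * \<epsilon>) \<longrightarrow>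
        0 \<le> ln (lam G n) / risk G - \<rho> \<and> ln (lam G n) / risk G - \<rho> \<le> \<epsilon> \<and>
        approximates_value G \<epsilon> (ln (lam G n) / risk G)))"
proof -
  let ?a = "\<lambda>n. ln (lam G n) / risk G" and ?b = "\<lambda>n. ln (zet G n) / risk G"
  have trap: "no_joint_trap G"
    by (rule irreducible_imp_no_joint_trap[OF game]) (rule irreducible)
  note dec = decseq_log_lam[OF game] and inc = incseq_log_zet[OF game]
  note gap = log_lam_minus_log_zet_tendsto_0[OF game trap]
  have "0 \<le> ?a n" for n
    using zet_ge_1[OF game, of n] zet_le_lam[OF game, of n] risk_pos[OF game] by simp
  then obtain \<rho> where a: "?a \<longlonglongrightarrow> \<rho>"
    using decseq_convergent[OF dec] by blast
  have b: "?b \<longlonglongrightarrow> \<rho>"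
    using tendsto_diff[OF a gap] by simp
  have upper: "upper_value G i \<le> ereal \<rho>" for i
    using a by (intro LIMSEQ_le_const[of "\<lambda>n. ereal (?a n)"]) (auto intro: upper_value_le[OF game])
  have lower: "ereal \<rho> \<le> lower_value G i" for i
    using b by (intro LIMSEQ_le_const2[of "\<lambda>n. ereal (?b n)"]) (auto intro: lower_value_ge[OF game])
  have upper_eq: "upper_value G i = ereal \<rho>" and lower_eq: "lower_value G i = ereal \<rho>" for i
    using upper[of i] lower[of i] lower_value_le_upper_value[of G i] by auto
  have ratio: "lam G n / zet G n \<le> exp (risk G * \<epsilon>) \<longleftrightarrow> ?a n - ?b n \<le> \<epsilon>" for n \<epsilon>
  proof -
    have "lam G n / zet G n = exp (ln (lam G n) - ln (zet G n))"
      using lam_pos[OF game, of n] zet_pos[OF game, of n] by (simp add: exp_diff)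
    then show ?thesis
      using risk_pos[OF game] by (simp add: field_simps)
  qed
  have "\<exists>n\<ge>1. lam G n / zet G n \<le> exp (risk G * \<epsilon>)" if "0 < \<epsilon>" for \<epsilon>
  proof -
    have "\<forall>\<^sub>F n in sequentially. ?a n - ?b n < \<epsilon> \<and> 1 \<le> n"
      using order_tendstoD(2)[OF gap that] eventually_ge_at_top by (rule eventually_conj)
    then obtain n where "?a n - ?b n < \<epsilon>" "1 \<le> n"
      using eventually_happens by force
    then show ?thesis
      unfolding ratio by (intro exI[of _ n]) simp
  qed
  moreover have "0 \<le> ?a n - \<rho> \<and> ?a n - \<rho> \<le> \<epsilon> \<and> approximates_value G \<epsilon> (?a n)"
    if "lam G n / zet G n \<le> exp (risk G * \<epsilon>)" for n \<epsilon>
  proof -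
    have "?b n \<le> \<rho>" "\<rho> \<le> ?a n"
      using incseq_le[OF inc b] decseq_ge[OF dec a] by blast+
    then have "0 \<le> ?a n - \<rho>" "?a n - \<rho> \<le> \<epsilon>"
      using that unfolding ratio by linarith+
    then show ?thesis
      by (simp add: approximates_value_def game_value_def upper_eq)
  qed
  moreover have "value_exists G" "game_value G i = ereal \<rho>" for i
    by (simp_all add: value_exists_def game_value_def upper_eq lower_eq)
  ultimately show ?thesis
    using a b dec inc by blast
qed

end
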